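(* Let $(\mathcal W,S)$ be an irreducible Coxeter system with $S$ finite, and let $c\in\mathcal W$ be a Coxeter element. Let $\alpha\in\mathcal P(c)$ and let $\Psi$ be a finite nonempty subset of $\mathcal P(c)$. (a) The lattice $\mathfrak N(\alpha)\cap\mathfrak M(c)$ (resp. $\mathfrak N(\Psi)\cap\mathfrak M(c)$) has a unique least element $W_\alpha$ (resp. $W_\Psi$), which is a minimal element of $\mathfrak N(\alpha)$ (resp. $\mathfrak N(\Psi)$) with respect to $\preceq$. One obtains a map $\nu:\mathcal P(c)\to\mathfrak M(c)$, $\nu(\alpha)=W_\alpha$, which extends to the map $\xi:\mathfrak f(c)\to\mathfrak M(c)$, $\xi(\Psi)=W_\Psi$, where $\mathfrak f(c)$ is the set of finite subsets of $\mathcal P(c)$. (b) The image of $\nu$ is contained in $\mathfrak P(c)$. Hence $W_\alpha=W_{r,x}$ for uniquely determined $r>0$ and $x\in\Gamma_0$. (c) With $r,x$ as in (b), $\alpha=\rho\left(W_{r,x}^T\right)\left(-\alpha_{\rho(x)}\right)$, and $\rho\left(W_{i,x}^T\right)\left(-\alpha_{\rho(x)}\right)>0$ if $0<i<r$. (d) The map $\nu:\mathcal P(c)\to\mathfrak M(c)$ is injective.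
   Context: Coxeter setting. $(\mathcal W,S)$ has Coxeter matrix $(m(s,s'))_{s,s'\in S}$. Its Coxeter graph $\Gamma$ has vertex set $\Gamma_0$ with a fixed bijection $\rho:\Gamma_0\to S$; distinct vertices $x,y$ are joined by an edge (exactly one) iff $2<m(\rho(x),\rho(y))\le\infty$; irreducible means that $\Gamma$ is connected. Graph monoid. $\mathfrak M$ is the quotient of the free monoid on $\Gamma_0$ by the congruence generated by $vw\sim wv$ for all distinct $v,w\in\Gamma_0$ not joined by an edge. Its elements are written as words $X=x_l\cdots x_1$ ($x_j\in\Gamma_0$, $l\ge 0$; $1$ is the empty word); $\mathrm{Supp}\,X=\{x_1,\dots,x_l\}$; $X$ is multiplicity-free if the $x_j$ are pairwise distinct; $X^T=x_1\cdots x_l$. The letter $\rho$ also denotes the induced monoid homomorphism $\mathfrak M\to\mathcal W$. Partial order on $\mathfrak M$: $Y\preceq X$ iff $X=UY$ for some $U\in\mathfrak M$. Roots. $\mathbb V$ is the real vector space with basis $\{\alpha_s\mid s\in S\}$ and symmetric bilinear form $B(\alpha_s,\alpha_{s'})=-2\cos\frac{\pi}{m(s,s')}$ (with $\frac{\pi}{\infty}=0$). $\mathcal W$ acts on $\mathbb V$ by $s\lambda=\lambda-B(\alpha_s,\lambda)\alpha_s$. The roots are the vectors $w(\alpha_s)$, $w\in\mathcal W$, $s\in S$. A root is positive ($>0$), resp. negative ($<0$), if all its coordinates in the basis $\{\alpha_s\}$ are $\ge 0$, resp. $\le 0$. Coxeter element and admissible words. $c=s_n\cdots s_1$, where $s_1,\dots,s_n$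 are all the elements of $S$ in some order, and $v_j=\rho^{-1}(s_j)$. The $c$-orientation of $\Gamma$ directs each edge between $v_i$ and $v_j$ with $j>i$ as $v_j\to v_i$ (it depends only on the element $c$); $(\Gamma,c)$ denotes the resulting acyclic quiver. A sink is a vertex at which no arrow starts. A word $X=x_l\cdots x_1$ is $c$-admissible if $x_1$ is a sink for the $c$-orientation and, for $1<j\le l$, $x_j$ is a sink for the orientation obtained from the $c$-orientation by reversing all arrows incident to $x_1$, then all arrows incident to $x_2$, and so on up to $x_{j-1}$. This is well defined on elements of $\mathfrak M$; $\mathfrak M(c)\subset\mathfrak M$ is the set of $c$-admissible elements. It is known that $(\mathfrak M(c),\preceq)$ is a lattice. Negation. $X\in\mathfrak M$ negates a root $\alpha>0$ if $\rho(X)\alpha<0$, and negates a finite set $\Psi$ of positive roots if it negates every element of $\Psi$; $\mathfrak N(\alpha)$ (resp. $\mathfrak N(\Psi)$) is the set of all elements of $\mathfrak M$ negating $\alpha$ (resp. $\Psi$). A root $\alpha>0$ is $c$-preprojective if some $X\in\mathfrak M(c)$ negates $\alpha$; $\mathcal P(c)$ is the set of $c$-preprojective roots. The sets $\mathfrak N(\alpha)\cap\mathfrak M(c)$ and $\mathfrak N(\Psi)\cap\mathfrak M(c)$ are sublattices of $\mathfrak M(c)$. For the empty subset, $W_\emptyset=1$. In "extends", $\alpha$ is identified with $\{\alpha\}$. Principal words. $\Gamma_0$ is a poset: $x\le y$ iff there is a directed path (possibly trivial) from $x$ to $y$ in $(\Gamma,c)$. A filter is an upward closed subset; $\langle x\rangle=\{y\mid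 y\ge x\}$. The hull $H_c(\Theta)$ of a filter $\Theta$ is the smallest filter containing $\Theta$ and every vertex of $\Gamma_0\setminus\Theta$ joined by an edge to a vertex of $\Theta$. For $r>0$ and $x\in\Gamma_0$, $W_{r,x}\in\mathfrak M$ is the element $X_r\cdots X_1$ where (i) each $X_j$ is multiplicity-free and $c$-admissible; (ii) $\mathrm{Supp}\,X_r=\langle x\rangle$; (iii) $H_c(\mathrm{Supp}\,X_{j+1})=\mathrm{Supp}\,X_j$ for $0<j<r$. (For each filter there is exactly one multiplicity-free $c$-admissible element with that support, so $W_{r,x}$ is well defined.) $\mathfrak P(c)$, the set of $c$-principal elements, consists of all $W_{r,x}$ together with the empty word. *)

theory Defs
  imports Complex_Main "HOL-Library.Extended_Nat" "HOL-Algebra.Generated_Groups"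
begin

section \<open>Presentations by words\<close>

text \<open>The congruence on the free monoid \<open>lists A\<close> (concatenation as product) generated by
  the pairs in \<open>R\<close>.\<close>

inductive_set word_cong :: "'a set \<Rightarrow> ('a list \<times> 'a list) set \<Rightarrow> ('a list \<times> 'a list) set"
  for A R where
  gen: "(u, v) \<in> R \<Longrightarrow> u \<in> lists A \<Longrightarrow> v \<in> lists A \<Longrightarrow> (u, v) \<in> word_cong A R"
| refl: "u \<in> lists A \<Longrightarrow> (u, u) \<in> word_cong A R"
| sym: "(u, v) \<in> word_cong A R \<Longrightarrow> (v, u) \<in> word_cong A R"
| trans: "(u, v) \<in> word_cong A R \<Longrightarrow> (v, w) \<in> word_cong A R \<Longrightarrow> (u, w) \<in> word_cong A R"
| mult: "(u, v) \<in> word_cong A R \<Longrightarrow> (u', v') \<in> word_cong A R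
          \<Longrightarrow> (u @ u', v @ v') \<in> word_cong A R"

definition word_prod :: "('a, 'b) monoid_scheme \<Rightarrow> 'a list \<Rightarrow> 'a" where
  "word_prod M xs = foldr (\<lambda>x y. x \<otimes>\<^bsub>M\<^esub> y) xs \<one>\<^bsub>M\<^esub>"

section \<open>Coxeter systems and their graphs\<close>

text \<open>The group \<open>W\<close> itself is the underlying monoid of the record; \<open>gens\<close> is \<open>S\<close>, \<open>cmat\<close> the
  Coxeter matrix, \<open>verts\<close> the vertex set of the Coxeter graph and \<open>rho\<close> its labelling by \<open>S\<close>.\<close>

record ('g, 'v) coxeter_datum = "'g monoid" +
  gens :: "'g set"
  cmat :: "'g \<Rightarrow> 'g \<Rightarrow> enat"
  verts :: "'v set"
  rho :: "'v \<Rightarrow> 'g"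

definition coxeter_relators :: "('g, 'v) coxeter_datum \<Rightarrow> ('g list \<times> 'g list) set" where
  "coxeter_relators D =
     {(concat (replicate k [s, t]), []) | s t k.
        s \<in> gens D \<and> t \<in> gens D \<and> cmat D s t = enat k}"

text \<open>The last but one conjunct, together with generation, says that \<open>W\<close> is presented by
  \<open>(s t)\<^bsup>m(s,t)\<^esup> = 1\<close> for \<open>m(s,t) < \<infinity>\<close>. As \<open>m(s,s) = 1\<close> makes every generator
  its own inverse, the monoid presentation and the group presentation coincide.\<close>

definition coxeter_system :: "('g, 'v) coxeter_datum \<Rightarrow> bool" where
  "coxeter_system D \<longleftrightarrow>
     group D \<and> gens D \<subseteq> carrier D \<and> generate D (gens D) = carrier D \<and>
     (\<forall>s \<in> gens D. cmat D s s = 1) \<and>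
     (\<forall>s \<in> gens D. \<forall>t \<in> gens D. cmat D s t = cmat D t s) \<and>
     (\<forall>s \<in> gens D. \<forall>t \<in> gens D. s \<noteq> t \<longrightarrow> cmat D s t \<ge> 2) \<and>
     (\<forall>us \<in> lists (gens D). \<forall>vs \<in> lists (gens D).
        word_prod D us = word_prod D vs \<longleftrightarrow>
        (us, vs) \<in> word_cong (gens D) (coxeter_relators D)) \<and>
     bij_betw (rho D) (verts D) (gens D)"

definition edges :: "('g, 'v) coxeter_datum \<Rightarrow> 'v rel" where
  "edges D = {(x, y). x \<in> verts D \<and> y \<in> verts D \<and> x \<noteq> y \<and> cmat D (rho D x) (rho D y) > 2}"

definition coxeter_irreducible :: "('g, 'v) coxeter_datum \<Rightarrow> bool" where
  "coxeter_irreducible D \<longleftrightarrow> (\<forall>x \<in> verts D. \<forall>y \<in> verts D. (x, y) \<in> (edges D)\<^sup>*)"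

section \<open>The graph monoid\<close>

definition graph_cong :: "('g, 'v) coxeter_datum \<Rightarrow> ('v list \<times> 'v list) set" where
  "graph_cong D = word_cong (verts D)
     {([v, w], [w, v]) | v w.
        v \<in> verts D \<and> w \<in> verts D \<and> v \<noteq> w \<and> (v, w) \<notin> edges D}"

text \<open>A word \<open>x\<^sub>l \<dots> x\<^sub>1\<close> is the list \<open>[x\<^sub>l, \<dots>, x\<^sub>1]\<close>, so the letter that acts
  first is the last entry. Elements of the graph monoid are congruence classes of such lists.\<close>

definition graph_monoid :: "('g, 'v) coxeter_datum \<Rightarrow> 'v list set monoid" where
  "graph_monoid D =
     \<lparr> carrier = lists (verts D) // graph_cong D,
       mult = (\<lambda>X Y. \<Union>xs \<in> X. \<Union>ys \<in> Y. graph_cong D `` {xs @ ys}),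
       one = graph_cong D `` {[]} \<rparr>"

definition Supp :: "'v list set \<Rightarrow> 'v set" where
  "Supp X = \<Union> (set ` X)"

definition multiplicity_free :: "'v list set \<Rightarrow> bool" where
  "multiplicity_free X \<longleftrightarrow> (\<forall>xs \<in> X. distinct xs)"

definition word_transpose :: "'v list set \<Rightarrow> 'v list set" where
  "word_transpose X = rev ` X"

definition rho_hom :: "('g, 'v) coxeter_datum \<Rightarrow> 'v list set \<Rightarrow> 'g" where
  "rho_hom D X = the_elem ((\<lambda>xs. word_prod D (map (rho D) xs)) ` X)"

definition prec :: "('g, 'v) coxeter_datum \<Rightarrow> 'v list set \<Rightarrow> 'v list set \<Rightarrow> bool" where
  "prec D Y X \<longleftrightarrow> (\<exists>U \<in> carrier (graph_monoid D). X = U \<otimes>\<^bsub>graph_monoid D\<^esub> Y)"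

definition prec_order :: "('g, 'v) coxeter_datum \<Rightarrow> 'v list set gorder" where
  "prec_order D = \<lparr> carrier = carrier (graph_monoid D), eq = (=), le = prec D \<rparr>"

definition prec_minimal ::
    "('g, 'v) coxeter_datum \<Rightarrow> 'v list set \<Rightarrow> 'v list set set \<Rightarrow> bool" where
  "prec_minimal D W N \<longleftrightarrow> W \<in> N \<and> (\<forall>Y \<in> N. prec D Y W \<longrightarrow> Y = W)"

section \<open>Roots\<close>

text \<open>A vector is its coordinate function with respect to the basis \<open>\<alpha>\<^sub>s\<close>, \<open>s \<in> S\<close>.
  Coordinates outside \<open>S\<close> carry no meaning: they vanish on every \<open>\<alpha>\<^sub>s\<close>, hence on every root.\<close>

definition pi_over :: "enat \<Rightarrow> real" where
  "pi_over m = (case m of enat k \<Rightarrow> pi / real k | \<infinity> \<Rightarrow> 0)"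

definition simple_root :: "'g \<Rightarrow> 'g \<Rightarrow> real" where
  "simple_root s = (\<lambda>t. of_bool (t = s))"

definition bform :: "('g, 'v) coxeter_datum \<Rightarrow> ('g \<Rightarrow> real) \<Rightarrow> ('g \<Rightarrow> real) \<Rightarrow> real" where
  "bform D u v =
     (\<Sum>s \<in> gens D. \<Sum>t \<in> gens D. u s * v t * (- 2 * cos (pi_over (cmat D s t))))"

definition reflection :: "('g, 'v) coxeter_datum \<Rightarrow> 'g \<Rightarrow> ('g \<Rightarrow> real) \<Rightarrow> ('g \<Rightarrow> real)" where
  "reflection D s v = (\<lambda>t. v t - bform D (simple_root s) v * simple_root s t)"

text \<open>The action of \<open>w\<close> is computed along any word in \<open>S\<close> representing \<open>w\<close>; the result does not
  depend on the word, since the reflections satisfy the Coxeter relations.\<close>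

definition act :: "('g, 'v) coxeter_datum \<Rightarrow> 'g \<Rightarrow> ('g \<Rightarrow> real) \<Rightarrow> ('g \<Rightarrow> real)" where
  "act D w v =
     (THE u. \<exists>ss \<in> lists (gens D). word_prod D ss = w \<and> u = foldr (reflection D) ss v)"

definition roots :: "('g, 'v) coxeter_datum \<Rightarrow> ('g \<Rightarrow> real) set" where
  "roots D = {act D w (simple_root s) | w s. w \<in> carrier D \<and> s \<in> gens D}"

definition pos_root :: "('g, 'v) coxeter_datum \<Rightarrow> ('g \<Rightarrow> real) \<Rightarrow> bool" where
  "pos_root D v \<longleftrightarrow> v \<in> roots D \<and> (\<forall>s \<in> gens D. v s \<ge> 0)"

definition neg_root :: "('g, 'v) coxeter_datum \<Rightarrow> ('g \<Rightarrow> real) \<Rightarrow> bool" where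
  "neg_root D v \<longleftrightarrow> v \<in> roots D \<and> (\<forall>s \<in> gens D. v s \<le> 0)"

section \<open>Coxeter elements and admissible words\<close>

definition coxeter_word :: "('g, 'v) coxeter_datum \<Rightarrow> 'g \<Rightarrow> 'g list \<Rightarrow> bool" where
  "coxeter_word D c cs \<longleftrightarrow> distinct cs \<and> set cs = gens D \<and> word_prod D cs = c"

definition coxeter_element :: "('g, 'v) coxeter_datum \<Rightarrow> 'g \<Rightarrow> bool" where
  "coxeter_element D c \<longleftrightarrow> (\<exists>cs. coxeter_word D c cs)"

text \<open>In the list \<open>[s\<^sub>n, \<dots>, s\<^sub>1]\<close> larger indices stand further left, so each arrow points from
  the earlier to the later entry.\<close>

definition word_orientation :: "('g, 'v) coxeter_datum \<Rightarrow> 'g list \<Rightarrow> 'v rel" where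
  "word_orientation D cs =
     {(x, y) \<in> edges D. \<exists>i j. i < j \<and> j < length cs \<and> cs ! i = rho D x \<and> cs ! j = rho D y}"

text \<open>The orientation is the same for all expressions of \<open>c\<close>, so the choice is immaterial.\<close>

definition arrows :: "('g, 'v) coxeter_datum \<Rightarrow> 'g \<Rightarrow> 'v rel" where
  "arrows D c = word_orientation D (SOME cs. coxeter_word D c cs)"

definition sink :: "('g, 'v) coxeter_datum \<Rightarrow> 'v rel \<Rightarrow> 'v \<Rightarrow> bool" where
  "sink D A x \<longleftrightarrow> x \<in> verts D \<and> (\<forall>y. (x, y) \<notin> A)"

definition reverse_at :: "'v \<Rightarrow> 'v rel \<Rightarrow> 'v rel" where
  "reverse_at x A = {(a, b). if a = x \<or> b = x then (b, a) \<in> A else (a, b) \<in> A}"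

text \<open>Here the letters are listed in the order \<open>x\<^sub>1, \<dots>, x\<^sub>l\<close> in which they are applied.\<close>

fun sink_sequence :: "('g, 'v) coxeter_datum \<Rightarrow> 'v rel \<Rightarrow> 'v list \<Rightarrow> bool" where
  "sink_sequence D A [] \<longleftrightarrow> True"
| "sink_sequence D A (x # xs) \<longleftrightarrow> sink D A x \<and> sink_sequence D (reverse_at x A) xs"

definition admissible_elements :: "('g, 'v) coxeter_datum \<Rightarrow> 'g \<Rightarrow> 'v list set set" where
  "admissible_elements D c =
     {graph_cong D `` {xs} | xs. xs \<in> lists (verts D) \<and> sink_sequence D (arrows D c) (rev xs)}"

section \<open>Negation\<close>

definition negates :: "('g, 'v) coxeter_datum \<Rightarrow> 'v list set \<Rightarrow> ('g \<Rightarrow> real) \<Rightarrow> bool" where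
  "negates D X \<alpha> \<longleftrightarrow> neg_root D (act D (rho_hom D X) \<alpha>)"

definition negators :: "('g, 'v) coxeter_datum \<Rightarrow> ('g \<Rightarrow> real) \<Rightarrow> 'v list set set" where
  "negators D \<alpha> = {X \<in> carrier (graph_monoid D). negates D X \<alpha>}"

definition set_negators :: "('g, 'v) coxeter_datum \<Rightarrow> ('g \<Rightarrow> real) set \<Rightarrow> 'v list set set" where
  "set_negators D \<Psi> = {X \<in> carrier (graph_monoid D). \<forall>\<alpha> \<in> \<Psi>. negates D X \<alpha>}"

definition preprojective_roots :: "('g, 'v) coxeter_datum \<Rightarrow> 'g \<Rightarrow> ('g \<Rightarrow> real) set" where
  "preprojective_roots D c =
     {\<alpha>. pos_root D \<alpha> \<and> (\<exists>X \<in> admissible_elements D c. negates D X \<alpha>)}"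

definition finite_preprojective_sets ::
    "('g, 'v) coxeter_datum \<Rightarrow> 'g \<Rightarrow> ('g \<Rightarrow> real) set set" where
  "finite_preprojective_sets D c = {\<Psi>. finite \<Psi> \<and> \<Psi> \<subseteq> preprojective_roots D c}"

definition nu :: "('g, 'v) coxeter_datum \<Rightarrow> 'g \<Rightarrow> ('g \<Rightarrow> real) \<Rightarrow> 'v list set" where
  "nu D c \<alpha> = (THE W. least (prec_order D) W (negators D \<alpha> \<inter> admissible_elements D c))"

definition xi :: "('g, 'v) coxeter_datum \<Rightarrow> 'g \<Rightarrow> ('g \<Rightarrow> real) set \<Rightarrow> 'v list set" where
  "xi D c \<Psi> =
     (if \<Psi> = {} then \<one>\<^bsub>graph_monoid D\<^esub>
      else (THE W. least (prec_order D) W (set_negators D \<Psi> \<inter> admissible_elements D c)))"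

section \<open>Principal words\<close>

definition is_filter :: "('g, 'v) coxeter_datum \<Rightarrow> 'g \<Rightarrow> 'v set \<Rightarrow> bool" where
  "is_filter D c F \<longleftrightarrow> F \<subseteq> verts D \<and>
     (\<forall>x \<in> F. \<forall>y \<in> verts D. (x, y) \<in> (arrows D c)\<^sup>* \<longrightarrow> y \<in> F)"

definition principal_filter :: "('g, 'v) coxeter_datum \<Rightarrow> 'g \<Rightarrow> 'v \<Rightarrow> 'v set" where
  "principal_filter D c x = {y \<in> verts D. (x, y) \<in> (arrows D c)\<^sup>*}"

definition filter_hull :: "('g, 'v) coxeter_datum \<Rightarrow> 'g \<Rightarrow> 'v set \<Rightarrow> 'v set" where
  "filter_hull D c \<Theta> = \<Inter> {F. is_filter D c F \<and> \<Theta> \<subseteq> F \<and>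
     (\<forall>v \<in> verts D - \<Theta>. (\<exists>w \<in> \<Theta>. (v, w) \<in> edges D) \<longrightarrow> v \<in> F)}"

definition principal_word :: "('g, 'v) coxeter_datum \<Rightarrow> 'g \<Rightarrow> nat \<Rightarrow> 'v \<Rightarrow> 'v list set" where
  "principal_word D c r x =
     (THE W. \<exists>X.
        (\<forall>j \<in> {1..r}. multiplicity_free (X j) \<and> X j \<in> admissible_elements D c) \<and>
        Supp (X r) = principal_filter D c x \<and>
        (\<forall>j. 0 < j \<and> j < r \<longrightarrow> filter_hull D c (Supp (X (Suc j))) = Supp (X j)) \<and>
        W = word_prod (graph_monoid D) (map X (rev [1..<Suc r])))"

definition principal_elements :: "('g, 'v) coxeter_datum \<Rightarrow> 'g \<Rightarrow> 'v list set set" where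
  "principal_elements D c =
     insert \<one>\<^bsub>graph_monoid D\<^esub> {principal_word D c r x | r x. 0 < r \<and> x \<in> verts D}"

end

theory Submission
  imports Defs "HOL-Library.Multiset"
begin

text \<open>An admissible element is determined by how often each vertex occurs in it; the functions
  arising are those with \<open>f a \<le> f b \<le> f a + 1\<close> for every arrow \<open>a \<rightarrow> b\<close>, and \<open>\<preceq>\<close> becomes the
  pointwise order. The functions negating a root \<open>\<beta>\<close> are closed under minima, since a positive vector
  that becomes negative under a word is supported in the letters of this word; so there is a least
  one. Its last letter \<open>x\<close> is unique, because \<open>\<beta>\<close> is sent to \<open>\<alpha>\<^sub>x\<close> just before, and this forces it to be
  the smallest admissible word in which \<open>x\<close> occurs \<open>r\<close> times, which is \<open>W\<^bsub>r,x\<^esub>\<close>.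

  For the positivity in (c) and for simultaneous negation of finitely many roots one has to see that
  the least negating words are reduced. The \<open>k\<close>-th occurrence of \<open>v\<close> in an admissible
  word has a root \<open>\<beta>(v,k)\<close> attached to it. The Euler form of the quiver is invariant under the reflections at sinks,
  so it expresses the coordinate at \<open>v\<close>, taken just before that letter, through \<open>\<beta>(v,k)\<close> alone.
  If \<open>\<beta>(v,k) = -\<beta>(u,i)\<close> for an earlier letter, comparing coordinates at the next letter adjacent to
  \<open>v\<close> shows that the root of that letter is repeated as well. Such repetitions climb to the last
  letter, where they contradict minimality.\<close>

section \<open>Every root is positive or negative\<close>

text \<open>The obstacle is that negation is not known to be monotone along \<open>prec\<close>: a
  root made negative by a word might become positive again later, so a pointwise maximum of two
  negating functions is of no direct use. A positive root can come back only at a letter whose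
  attached root is negative. This is why reducedness of the least negating words matters: once all
  attached roots are positive, a positive root that has turned negative stays negative. Maxima
  preserve reducedness, because \<beta>(v,k) depends on v and k only and every letter of a maximum
  is already a letter of one of the two functions; so the maximum of the least words negates
  finitely many roots at once. The Euler form is taken instead of \<open>bform\<close> because at a
  sink x its value on \<alpha>_x and q is the bare coordinate of q at x, without a contribution of
  the neighbours. Opposite attached roots therefore give opposite coordinates, at two different
  moments, for every vector that is transported. A positive coordinate at the later letter thus
  reveals a negative root at the earlier one, and this makes repetitions climb.\<close>

lemma word_prod_Nil [simp]: "word_prod M [] = \<one>\<^bsub>M\<^esub>"
  and word_prod_Cons [simp]: "word_prod M (x # xs) = x \<otimes>\<^bsub>M\<^esub> word_prod M xs"
  by (simp_all add: word_prod_def)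

text \<open>Letters are added on the left, so every nonempty word ends in \<open>t\<close>, the
  letter that acts first.\<close>

fun alternating :: "'a \<Rightarrow> 'a \<Rightarrow> nat \<Rightarrow> 'a list" where
  "alternating s t 0 = []"
| "alternating s t (Suc k) = (if even k then t else s) # alternating s t k"

lemma length_alternating [simp]: "length (alternating s t k) = k"
  by (induction k) auto

lemma set_alternating: "set (alternating s t k) \<subseteq> {s, t}"
  by (induction k) auto

lemma alternating_add: "\<exists>Q. length Q = j \<and> alternating s t (j + m) = Q @ alternating s t m"
proof (induction j)
  case 0
  then show ?case by simp
next
  case (Suc j)
  then obtain Q where "length Q = j" "alternating s t (j + m) = Q @ alternating s t m" by blast
  then show ?case
    by (intro exI[of _ "(if even (j + m) then t else s) # Q"]) simp
qed

lemma alternating_even: "alternating s t (2 * k) = concat (replicate k [s, t])"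
  by (induction k) auto

section \<open>The bilinear form, the reflections and the action of the group\<close>

locale coxeter =
  fixes D :: "('g, 'v) coxeter_datum"
  assumes coxeter_system: "coxeter_system D" and finite_gens: "finite (gens D)"
begin

abbreviation "S \<equiv> gens D"
abbreviation "\<alpha> \<equiv> simple_root :: 'g \<Rightarrow> 'g \<Rightarrow> real"
abbreviation "along ss v \<equiv> foldr (reflection D) ss v"

definition gram :: "'g \<Rightarrow> 'g \<Rightarrow> real" where
  "gram s t = - 2 * cos (pi_over (cmat D s t))"

lemma group_D: "group D" and gens_carrier: "S \<subseteq> carrier D"
  and generate_gens: "generate D S = carrier D"
  and cmat_self: "s \<in> S \<Longrightarrow> cmat D s s = 1"
  and cmat_sym: "s \<in> S \<Longrightarrow> t \<in> S \<Longrightarrow> cmat D s t = cmat D t s"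
  and cmat_ge2: "s \<in> S \<Longrightarrow> t \<in> S \<Longrightarrow> s \<noteq> t \<Longrightarrow> cmat D s t \<ge> 2"
  and presentation: "us \<in> lists S \<Longrightarrow> vs \<in> lists S \<Longrightarrow>
        word_prod D us = word_prod D vs \<longleftrightarrow> (us, vs) \<in> word_cong S (coxeter_relators D)"
  and rho_bij: "bij_betw (rho D) (verts D) S"
  using coxeter_system unfolding coxeter_system_def by blast+

sublocale group D by (rule group_D)

lemma gram_self: "s \<in> S \<Longrightarrow> gram s s = 2"
  by (simp add: gram_def cmat_self pi_over_def one_enat_def)

lemma gram_sym: "s \<in> S \<Longrightarrow> t \<in> S \<Longrightarrow> gram s t = gram t s"
  by (simp add: gram_def cmat_sym)

lemma gram_cases:
  assumes "s \<in> S" "t \<in> S" "s \<noteq> t"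
  obtains (inf) "cmat D s t = \<infinity>" "gram s t = -2"
    | (fin) k where "cmat D s t = enat k" "k \<ge> 2" "gram s t = - 2 * cos (pi / k)"
proof (cases "cmat D s t")
  case (enat k)
  then have "k \<ge> 2" using cmat_ge2[OF assms] by (simp add: numeral_eq_enat)
  then show ?thesis using enat fin by (auto simp: gram_def pi_over_def)
next
  case infinity
  then show ?thesis using inf by (auto simp: gram_def pi_over_def)
qed

lemma cos_pi_div_nonneg:
  assumes "k \<ge> 2" shows "cos (pi / real k) \<ge> 0"
proof (rule cos_ge_zero)
  show "pi / real k \<le> pi / 2" using assms by (intro divide_left_mono) auto
  have "0 \<le> pi / real k" by simp
  then show "- (pi / 2) \<le> pi / real k" using pi_ge_zero by linarith
qed

lemma gram_nonpos:
  assumes "s \<in> S" "t \<in> S" "s \<noteq> t" shows "gram s t \<le> 0"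
  using assms by (cases rule: gram_cases) (use cos_pi_div_nonneg in auto)

lemma gram_neg_iff:
  assumes "s \<in> S" "t \<in> S" "s \<noteq> t" shows "gram s t < 0 \<longleftrightarrow> cmat D s t > 2"
  using assms
proof (cases rule: gram_cases)
  case inf
  then show ?thesis by (simp add: numeral_eq_enat)
next
  case (fin k)
  show ?thesis
  proof (cases "k = 2")
    case True
    then show ?thesis using fin by (simp add: numeral_eq_enat)
  next
    case False
    then have k: "k > 2" using fin by simp
    have "cos (pi / real k) > 0"
    proof (rule cos_gt_zero)
      show "0 < pi / real k" using k by simp
      show "pi / real k < pi / 2" using k by (intro divide_strict_left_mono) auto
    qed
    then show ?thesis using fin k by (simp add: numeral_eq_enat)
  qed
qed

lemma gram_eq_0_iff:
  assumes "s \<in> S" "t \<in> S" "s \<noteq> t" shows "gram s t = 0 \<longleftrightarrow> \<not> cmat D s t > 2"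
  using gram_neg_iff[OF assms] gram_nonpos[OF assms] by linarith

lemma bform_gram: "bform D u v = (\<Sum>s\<in>S. \<Sum>t\<in>S. u s * v t * gram s t)"
  by (simp add: bform_def gram_def)

lemma bform_sym: "bform D u v = bform D v u"
  unfolding bform_gram
  by (subst sum.swap) (auto intro!: sum.cong simp: gram_sym)

lemma bform_lin: "bform D u (\<lambda>r. a * v r + b * w r) = a * bform D u v + b * bform D u w"
  unfolding bform_gram sum_distrib_left sum.distrib[symmetric]
  by (auto intro!: sum.cong simp: algebra_simps)

lemma bform_simple: "s \<in> S \<Longrightarrow> bform D (\<alpha> s) v = (\<Sum>t\<in>S. v t * gram s t)"
proof -
  assume s: "s \<in> S"
  have "bform D (\<alpha> s) v = (\<Sum>r\<in>S. if r = s then \<Sum>t\<in>S. v t * gram s t else 0)"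
    unfolding bform_gram by (auto simp: simple_root_def intro!: sum.cong)
  then show ?thesis using s finite_gens by (simp add: sum.delta)
qed

lemma bform_simple2: "s \<in> S \<Longrightarrow> t \<in> S \<Longrightarrow> bform D (\<alpha> s) (\<alpha> t) = gram s t"
proof -
  assume st: "s \<in> S" "t \<in> S"
  have "bform D (\<alpha> s) (\<alpha> t) = (\<Sum>r\<in>S. if r = t then gram s r else 0)"
    unfolding bform_simple[OF st(1)] by (auto simp: simple_root_def intro!: sum.cong)
  then show ?thesis using st finite_gens by (simp add: sum.delta)
qed

lemma reflection_apply: "reflection D s v = (\<lambda>r. 1 * v r + (- bform D (\<alpha> s) v) * \<alpha> s r)"
  by (simp add: reflection_def)

lemma reflection_other: "r \<noteq> s \<Longrightarrow> reflection D s v r = v r"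
  by (simp add: reflection_def simple_root_def)

lemma reflection_self: "reflection D s v s = v s - bform D (\<alpha> s) v"
  by (simp add: reflection_def simple_root_def)

lemma reflection_lin:
  "reflection D s (\<lambda>r. a * v r + b * w r) = (\<lambda>r. a * reflection D s v r + b * reflection D s w r)"
  by (simp add: reflection_def bform_lin algebra_simps)

lemma reflection_uminus: "reflection D s (- v) = - reflection D s v"
  using reflection_lin[of s "-1" v 0 v] by (simp add: fun_Compl_def)

lemma reflection_simple: "s \<in> S \<Longrightarrow> reflection D s (\<alpha> s) = - \<alpha> s"
  by (rule ext) (simp add: reflection_def bform_simple2 gram_self)

lemma bform_reflection:
  assumes "s \<in> S" shows "bform D (reflection D s u) (reflection D s v) = bform D u v"
proof -
  have e: "bform D w (reflection D s v) = bform D w v - bform D (\<alpha> s) v * bform D w (\<alpha> s)" for w v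
    unfolding reflection_apply bform_lin by simp
  have "bform D (\<alpha> s) (\<alpha> s) = 2" using assms by (simp add: bform_simple2 gram_self)
  then show ?thesis
    by (simp add: e bform_sym[of "reflection D s u"] bform_sym[of u] bform_sym[of v "\<alpha> s"] algebra_simps)
qed

lemma reflection_reflection: "s \<in> S \<Longrightarrow> reflection D s (reflection D s v) = v"
proof -
  assume s: "s \<in> S"
  have "bform D (\<alpha> s) (reflection D s v) = - bform D (\<alpha> s) v"
    unfolding reflection_apply bform_lin using s by (simp add: bform_simple2 gram_self)
  then show ?thesis by (subst reflection_def) (simp add: reflection_def)
qed

lemma along_lin:
  "along ss (\<lambda>r. a * v r + b * w r) = (\<lambda>r. a * along ss v r + b * along ss w r)"
  by (induction ss) (simp_all add: reflection_lin)

lemma along_uminus: "along ss (- v) = - along ss v"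
  by (induction ss) (simp_all only: foldr.simps o_apply id_apply reflection_uminus)

lemma along_other: "r \<notin> set ss \<Longrightarrow> along ss v r = v r"
  by (induction ss) (auto simp: reflection_other)

lemma bform_along: "ss \<in> lists S \<Longrightarrow> bform D (along ss u) (along ss v) = bform D u v"
  by (induction ss) (auto simp: bform_reflection)

lemma along_rev: "ss \<in> lists S \<Longrightarrow> along (rev ss) (along ss v) = v"
  by (induction ss) (auto simp: reflection_reflection)

lemma along_rev': "ss \<in> lists S \<Longrightarrow> along ss (along (rev ss) v) = v"
  using along_rev[of "rev ss" v] by (simp add: in_lists_conv_set)

text \<open>The coefficients of \<open>\<alpha>\<^sub>s\<close> and \<open>\<alpha>\<^sub>t\<close> in the roots of the rank two subsystem of \<open>s\<close> and \<open>t\<close>.\<close>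

definition dihedral_coeff :: "'g \<Rightarrow> 'g \<Rightarrow> real \<Rightarrow> real" where
  "dihedral_coeff s t x =
     (case cmat D s t of enat k \<Rightarrow> sin (x * (pi / k)) / sin (pi / k) | \<infinity> \<Rightarrow> x)"

lemma sin_pi_div_pos: "k \<ge> 2 \<Longrightarrow> sin (pi / real k) > 0"
  by (rule sin_gt_zero) (auto simp: field_simps)

text \<open>For finite m the recursion is sin((x+1)a) + sin((x-1)a) = 2 cos(a) sin(xa) with a =
  pi/m, and for infinite m its limit at a = 0. The argument is real because the coefficient with
  index k - 1 is also needed at k = 0.\<close>

lemma dihedral_coeff_simps:
  assumes "s \<in> S" "t \<in> S" "s \<noteq> t"
  shows "dihedral_coeff s t 0 = 0" "dihedral_coeff s t 1 = 1" "dihedral_coeff s t (-1) = -1"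
    "dihedral_coeff s t (x + 1) = - gram s t * dihedral_coeff s t x - dihedral_coeff s t (x - 1)"
proof -
  have "dihedral_coeff s t 0 = 0 \<and> dihedral_coeff s t 1 = 1 \<and> dihedral_coeff s t (-1) = -1 \<and>
    dihedral_coeff s t (x + 1) = - gram s t * dihedral_coeff s t x - dihedral_coeff s t (x - 1)"
    using assms
  proof (cases rule: gram_cases)
    case inf
    then show ?thesis by (simp add: dihedral_coeff_def)
  next
    case (fin k)
    have "sin ((x + 1) * (pi / k)) = 2 * cos (pi / k) * sin (x * (pi / k)) - sin ((x - 1) * (pi / k))"
      by (simp only: distrib_right left_diff_distrib sin_add sin_diff mult_1) simp
    then show ?thesis using fin sin_pi_div_pos[of k]
      by (simp add: dihedral_coeff_def diff_divide_distrib)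
  qed
  then show "dihedral_coeff s t 0 = 0" "dihedral_coeff s t 1 = 1" "dihedral_coeff s t (-1) = -1"
    "dihedral_coeff s t (x + 1) = - gram s t * dihedral_coeff s t x - dihedral_coeff s t (x - 1)"
    by blast+
qed

lemma dihedral_coeff_nonneg:
  assumes "s \<in> S" "t \<in> S" "s \<noteq> t" "0 \<le> x" "\<And>k. cmat D s t = enat k \<Longrightarrow> x \<le> k"
  shows "dihedral_coeff s t x \<ge> 0"
  using assms(1-3)
proof (cases rule: gram_cases)
  case inf
  then show ?thesis using assms by (simp add: dihedral_coeff_def)
next
  case (fin k)
  have "x * (pi / k) \<le> k * (pi / k)" using assms(5)[OF fin(1)] by (intro mult_right_mono) auto
  then have "sin (x * (pi / k)) \<ge> 0" using fin(2) assms(4) by (intro sin_ge_zero) auto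
  then show ?thesis using fin sin_pi_div_pos[of k] by (simp add: dihedral_coeff_def)
qed

lemma reflection_rank2:
  assumes "s \<in> S" "t \<in> S" "s \<noteq> t"
  shows "reflection D s (\<lambda>r. a * \<alpha> s r + b * \<alpha> t r) = (\<lambda>r. (- gram s t * b - a) * \<alpha> s r + b * \<alpha> t r)"
    "reflection D t (\<lambda>r. a * \<alpha> s r + b * \<alpha> t r) = (\<lambda>r. a * \<alpha> s r + (- gram s t * a - b) * \<alpha> t r)"
  using assms by (auto simp: reflection_def bform_lin bform_simple2 gram_self gram_sym[of t s]
      algebra_simps fun_eq_iff)

lemma along_alternating:
  assumes st: "s \<in> S" "t \<in> S" "s \<noteq> t"
  shows "along (alternating s t k) (\<alpha> s) =
      (if even k then (\<lambda>r. dihedral_coeff s t (k + 1) * \<alpha> s r + dihedral_coeff s t k * \<alpha> t r)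
       else (\<lambda>r. dihedral_coeff s t k * \<alpha> s r + dihedral_coeff s t (k + 1) * \<alpha> t r))" (is "?P k")
    and "along (alternating s t k) (\<alpha> t) =
      (if even k then (\<lambda>r. - dihedral_coeff s t k * \<alpha> s r + - dihedral_coeff s t (real k - 1) * \<alpha> t r)
       else (\<lambda>r. - dihedral_coeff s t (real k - 1) * \<alpha> s r + - dihedral_coeff s t k * \<alpha> t r))" (is "?Q k")
proof -
  note d = dihedral_coeff_simps[OF st]
  have d2: "dihedral_coeff s t (2 + real k) =
     - gram s t * dihedral_coeff s t (real k + 1) - dihedral_coeff s t (real k)" for k
    using d(4)[of "real k + 1"] by (simp add: add.commute)
  have "?P k \<and> ?Q k"
  proof (induction k)
    case 0
    then show ?case by (simp add: d)
  next
    case (Suc k)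
    show ?case
    proof (cases "even k")
      case True
      then have "along (alternating s t (Suc k)) v = reflection D t (along (alternating s t k) v)" for v
        by simp
      with Suc.IH True show ?thesis
        by (simp only: if_True reflection_rank2[OF st] even_Suc if_False)
          (simp add: d(4)[of k] d2 add.commute[of 1] add.commute[of "dihedral_coeff s t (real k - 1)"])
    next
      case False
      then have "along (alternating s t (Suc k)) v = reflection D s (along (alternating s t k) v)" for v
        by simp
      with Suc.IH False show ?thesis
        by (simp only: if_True reflection_rank2[OF st] even_Suc if_False simp_thms)
          (simp add: d(4)[of k] d2 add.commute[of 1] add.commute[of "dihedral_coeff s t (real k - 1)"])
    qed
  qed
  then show "?P k" "?Q k" by blast+
qed

text \<open>Periodicity of the sine shows that the word fixes \<alpha>_s and \<alpha>_t. The
  difference x between the image of v and v lies in their span, since no other coordinate is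
  touched, and it is orthogonal to both, since the word preserves the form. The rank two Gram
  determinant is \<open>4 - gram s t ^ 2\<close>, that is 4 sin(pi/k)^2, which is not 0; hence x
  vanishes. This is what makes \<open>act\<close> well defined.\<close>

lemma along_relator:
  assumes st: "s \<in> S" "t \<in> S" and k: "cmat D s t = enat k"
  shows "along (concat (replicate k [s, t])) v = v"
proof (cases "s = t")
  case True
  then have "k = 1" using k cmat_self[OF st(1)] by (simp add: one_enat_def)
  then show ?thesis using True st by (simp add: reflection_reflection)
next
  case False
  note st = st False
  obtain k2: "k \<ge> 2" and g: "gram s t = - 2 * cos (pi / k)"
    using st by (cases rule: gram_cases) (use k in auto)
  let ?w = "alternating s t (2 * k)"
  have w: "?w \<in> lists S" using set_alternating[of s t "2 * k"] st by auto
  have e: "(2 * real k + c) * (pi / k) = 2 * pi + c * (pi / k)" for c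
    using k2 by (auto simp: field_simps)
  have "dihedral_coeff s t (2 * real k + c) = dihedral_coeff s t c" for c :: real
    unfolding dihedral_coeff_def k enat.case e by (simp add: sin_add)
  from this[of 1] this[of "-1"] this[of 0] have "along ?w (\<alpha> s) = \<alpha> s" "along ?w (\<alpha> t) = \<alpha> t"
    by (simp_all add: along_alternating[OF st] dihedral_coeff_simps[OF st] add.commute[of 1])
  then have B: "bform D (\<alpha> s) (along ?w v) = bform D (\<alpha> s) v"
     "bform D (\<alpha> t) (along ?w v) = bform D (\<alpha> t) v" by (metis bform_along w)+
  define x where "x = (\<lambda>r. 1 * along ?w v r + (-1) * v r)"
  have x0: "x r = 0" if "r \<noteq> s" "r \<noteq> t" for r
    using that along_other[of r ?w v] set_alternating[of s t "2 * k"] by (auto simp: x_def)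
  have xx: "(\<Sum>r\<in>S. x r * gram u r) = x s * gram u s + x t * gram u t" for u
  proof -
    have "(\<Sum>r\<in>S. x r * gram u r) = (\<Sum>r\<in>{s, t}. x r * gram u r)"
      using st finite_gens x0 by (intro sum.mono_neutral_right) auto
    then show ?thesis using st by simp
  qed
  have "bform D (\<alpha> s) x = 0" "bform D (\<alpha> t) x = 0" unfolding x_def bform_lin using B by auto
  then have e: "2 * x s + gram s t * x t = 0" "gram s t * x s + 2 * x t = 0"
    using st by (auto simp: bform_simple xx gram_self gram_sym[of t s] mult.commute)
  have "gram s t ^ 2 = 4 - 4 * sin (pi / k) ^ 2" by (simp add: g power_mult_distrib cos_squared_eq)
  then have g4: "4 - gram s t ^ 2 \<noteq> 0" using sin_pi_div_pos[OF k2] by auto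
  have "(4 - gram s t ^ 2) * x s = 0" "(4 - gram s t ^ 2) * x t = 0"
    using e by algebra+
  then have "x s = 0" "x t = 0" using g4 by auto
  then have "x r = 0" for r using x0 by metis
  then have "along ?w v = v" by (auto simp: x_def fun_eq_iff)
  then show ?thesis by (simp add: alternating_even)
qed

text \<open>The parity of the length is carried along because it is the sign character of the group:
  it excludes that \<open>w\<close> and \<open>w s\<close> have the same length.\<close>

lemma word_cong_along:
  "(us, vs) \<in> word_cong S (coxeter_relators D) \<Longrightarrow>
     us \<in> lists S \<and> vs \<in> lists S \<and> even (length us + length vs) \<and> along us x = along vs x"
proof (induction arbitrary: x rule: word_cong.induct)
  case (gen u v)
  then show ?case using along_relator
    by (auto simp: coxeter_relators_def length_concat sum_list_replicate)
qed auto

lemma along_cong: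
  assumes "us \<in> lists S" "vs \<in> lists S" "word_prod D us = word_prod D vs"
  shows "along us x = along vs x" "even (length us) = even (length vs)"
  using word_cong_along[of us vs x] presentation[OF assms(1,2)] assms(3) by auto

lemma act_word_prod: "ss \<in> lists S \<Longrightarrow> act D (word_prod D ss) v = along ss v"
  unfolding act_def by (rule the_equality) (use along_cong in blast)+

lemma word_prod_closed [simp]: "ss \<in> lists S \<Longrightarrow> word_prod D ss \<in> carrier D"
  using gens_carrier by (induction ss) auto

lemma word_prod_append [simp]:
  "us \<in> lists S \<Longrightarrow> vs \<in> lists S \<Longrightarrow> word_prod D (us @ vs) = word_prod D us \<otimes>\<^bsub>D\<^esub> word_prod D vs"
  using gens_carrier by (induction us) (auto simp: m_assoc subset_iff)

lemma word_prod_relator: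
  assumes "s \<in> S" "t \<in> S" "cmat D s t = enat k"
  shows "word_prod D (concat (replicate k [s, t])) = \<one>\<^bsub>D\<^esub>"
proof -
  have l: "concat (replicate k [s, t]) \<in> lists S" using assms by (auto simp: in_lists_conv_set)
  have "(concat (replicate k [s, t]), []) \<in> word_cong S (coxeter_relators D)"
    using assms l by (intro word_cong.gen) (auto simp: coxeter_relators_def)
  then show ?thesis using presentation[OF l, of "[]"] by simp
qed

lemma gen_square: "s \<in> S \<Longrightarrow> s \<otimes>\<^bsub>D\<^esub> s = \<one>\<^bsub>D\<^esub>"
  using word_prod_relator[of s s 1] cmat_self[of s] gens_carrier
  by (auto simp: one_enat_def subset_iff)

lemma word_prod_rev: "ss \<in> lists S \<Longrightarrow> word_prod D (rev ss) \<otimes>\<^bsub>D\<^esub> word_prod D ss = \<one>\<^bsub>D\<^esub>"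
proof (induction ss)
  case (Cons s ss)
  then have [simp]: "s \<in> carrier D" "s \<in> S" "ss \<in> lists S" "rev ss \<in> lists S" using gens_carrier by auto
  have "word_prod D (rev (s # ss)) \<otimes>\<^bsub>D\<^esub> word_prod D (s # ss)
    = word_prod D (rev ss) \<otimes>\<^bsub>D\<^esub> ((s \<otimes>\<^bsub>D\<^esub> s) \<otimes>\<^bsub>D\<^esub> word_prod D ss)"
    by (simp add: m_assoc)
  then show ?case using Cons by (simp add: gen_square)
qed simp

lemma word_prod_surj: "w \<in> carrier D \<Longrightarrow> \<exists>ss\<in>lists S. word_prod D ss = w"
proof -
  assume "w \<in> carrier D"
  then have "w \<in> generate D S" by (simp add: generate_gens)
  then show ?thesis
  proof (induction rule: generate.induct)
    case one
    then show ?case by (intro bexI[of _ "[]"]) auto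
  next
    case (incl h)
    then show ?case using gens_carrier by (intro bexI[of _ "[h]"]) auto
  next
    case (inv h)
    then have "inv\<^bsub>D\<^esub> h = h" using gen_square gens_carrier by (intro inv_equality) auto
    then show ?case using gens_carrier inv by (intro bexI[of _ "[h]"]) auto
  next
    case (eng h1 h2)
    then show ?case by (metis append_in_lists_conv word_prod_append)
  qed
qed

section \<open>Word length and the sign of a root\<close>

definition len :: "'g \<Rightarrow> nat" where
  "len w = (LEAST n. \<exists>ss\<in>lists S. length ss = n \<and> word_prod D ss = w)"

lemma len_le: "ss \<in> lists S \<Longrightarrow> len (word_prod D ss) \<le> length ss"
  unfolding len_def by (rule Least_le) auto

lemma len_word:
  assumes "w \<in> carrier D"
  obtains ss where "ss \<in> lists S" "length ss = len w" "word_prod D ss = w"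
proof -
  have "\<exists>ss\<in>lists S. length ss = len w \<and> word_prod D ss = w"
    unfolding len_def by (rule LeastI_ex) (use word_prod_surj[OF assms] in auto)
  then show ?thesis using that by blast
qed

lemma len_mult_le:
  assumes "w \<in> carrier D" "ss \<in> lists S" shows "len (w \<otimes>\<^bsub>D\<^esub> word_prod D ss) \<le> len w + length ss"
proof -
  obtain us where "us \<in> lists S" "length us = len w" "word_prod D us = w" using len_word[OF assms(1)] .
  then show ?thesis using len_le[of "us @ ss"] assms by auto
qed

lemma len_mult_gen:
  assumes "w \<in> carrier D" "s \<in> S"
  shows "len (w \<otimes>\<^bsub>D\<^esub> s) = Suc (len w) \<or> Suc (len (w \<otimes>\<^bsub>D\<^esub> s)) = len w"
proof -
  have s: "s \<in> carrier D" using assms gens_carrier by auto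
  have 1: "len (w \<otimes>\<^bsub>D\<^esub> s) \<le> Suc (len w)" using len_mult_le[of w "[s]"] assms s by auto
  have "w = (w \<otimes>\<^bsub>D\<^esub> s) \<otimes>\<^bsub>D\<^esub> s" using assms s by (simp add: m_assoc gen_square)
  then have 2: "len w \<le> Suc (len (w \<otimes>\<^bsub>D\<^esub> s))" using len_mult_le[of "w \<otimes>\<^bsub>D\<^esub> s" "[s]"] assms s by auto
  obtain us where us: "us \<in> lists S" "length us = len w" "word_prod D us = w" using len_word[OF assms(1)] .
  obtain vs where vs: "vs \<in> lists S" "length vs = len (w \<otimes>\<^bsub>D\<^esub> s)" "word_prod D vs = w \<otimes>\<^bsub>D\<^esub> s"
    using len_word[of "w \<otimes>\<^bsub>D\<^esub> s"] assms s by auto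
  have "even (length (us @ [s])) = even (length vs)"
    using along_cong(2)[of "us @ [s]" vs] us vs assms s by auto
  then have "even (Suc (len w)) = even (len (w \<otimes>\<^bsub>D\<^esub> s))" using us vs by simp
  then have "len (w \<otimes>\<^bsub>D\<^esub> s) \<noteq> len w" by auto
  then show ?thesis using 1 2 by linarith
qed

lemma act_mult_word:
  assumes "w \<in> carrier D" "ss \<in> lists S"
  shows "act D (w \<otimes>\<^bsub>D\<^esub> word_prod D ss) x = act D w (along ss x)"
proof -
  obtain us where us: "us \<in> lists S" "word_prod D us = w" using word_prod_surj[OF assms(1)] by blast
  have "act D (word_prod D (us @ ss)) x = act D (word_prod D us) (along ss x)"
    using us assms(2) by (subst (1 2) act_word_prod) auto
  then show ?thesis using us assms by simp
qed

lemma act_lin: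
  assumes "w \<in> carrier D"
  shows "act D w (\<lambda>r. a * u r + b * v r) = (\<lambda>r. a * act D w u r + b * act D w v r)"
  using word_prod_surj[OF assms] act_word_prod along_lin by metis

text \<open>Peeling letters \<open>t\<close> and \<open>s\<close> alternately off the right end of \<open>w\<close> as long as the length
  drops leaves an element \<open>v\<close> that is shorter than both \<open>v s\<close> and \<open>v t\<close>, so that induction
  applies to \<open>v\<close>, and the peeled word is too short for the braid relation to occur in it.\<close>

lemma act_simple_nonneg:
  assumes "w \<in> carrier D" "s \<in> S" "len (w \<otimes>\<^bsub>D\<^esub> s) > len w"
  shows "\<forall>r\<in>S. act D w (\<alpha> s) r \<ge> 0"
  using assms
proof (induction "len w" arbitrary: w s rule: less_induct)
  case less
  have sc: "s \<in> carrier D" using less gens_carrier by auto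
  obtain us where us: "us \<in> lists S" "length us = len w" "word_prod D us = w" using len_word[OF less(2)] .
  show ?case
  proof (cases us rule: rev_cases)
    case Nil
    then show ?thesis using us act_word_prod[of "[]"] by (auto simp: simple_root_def)
  next
    case (snoc us' t)
    then have t: "t \<in> S" "us' \<in> lists S" "t \<in> carrier D" using us gens_carrier by auto
    have w: "w = word_prod D us' \<otimes>\<^bsub>D\<^esub> t" using us snoc t by auto
    have "len (word_prod D us') \<le> length us'" using t len_le by blast
    moreover have "len w \<le> len (word_prod D us') + 1"
      using len_mult_le[of "word_prod D us'" "[t]"] t w by auto
    ultimately have lw: "len w = len (word_prod D us') + 1" using us snoc by simp
    have "len (w \<otimes>\<^bsub>D\<^esub> t) < len w"
    proof -
      have "w \<otimes>\<^bsub>D\<^esub> t = word_prod D us'" using t w by (simp add: m_assoc gen_square)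
      then show ?thesis using lw by simp
    qed
    then have st: "s \<noteq> t" using less by auto
    define K where "K = {k. \<exists>v\<in>carrier D. w = v \<otimes>\<^bsub>D\<^esub> word_prod D (alternating s t k) \<and> len w = len v + k}"
    have alt: "alternating s t k \<in> lists S" for k using set_alternating[of s t k] less t by auto
    have "K \<subseteq> {..len w}" by (auto simp: K_def)
    then have fK: "finite K" using finite_subset by blast
    have K1: "1 \<in> K" unfolding K_def using w lw t by (auto intro!: bexI[of _ "word_prod D us'"])
    define k where "k = Max K"
    have kK: "k \<in> K" unfolding k_def using fK K1 by (intro Max_in) auto
    have k1: "k \<ge> 1" unfolding k_def using fK K1 by simp
    have kS: "Suc k \<notin> K" using Max_ge[OF fK, of "Suc k"] unfolding k_def by auto
    obtain v where v: "v \<in> carrier D" "w = v \<otimes>\<^bsub>D\<^esub> word_prod D (alternating s t k)" "len w = len v + k"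
      using kK unfolding K_def by blast
    \<comment> \<open>\<open>p\<close> is the letter that would lengthen the peeled word, so
      \<open>v p\<close> is longer by maximality of \<open>k\<close>; \<open>q\<close> is the first
      letter of the peeled word, so a shorter \<open>v q\<close> would shorten
      \<open>w\<close>.\<close>
    define p where "p = (if even k then t else s)"
    define q where "q = (if even k then s else t)"
    have pq: "p \<in> S" "q \<in> S" "p \<in> carrier D" "q \<in> carrier D" using less t sc by (auto simp: p_def q_def)
    have lp: "len (v \<otimes>\<^bsub>D\<^esub> p) > len v"
    proof (rule ccontr)
      assume "\<not> ?thesis"
      then have l: "len v = len (v \<otimes>\<^bsub>D\<^esub> p) + 1" using len_mult_gen[OF v(1) pq(1)] by auto
      have "(v \<otimes>\<^bsub>D\<^esub> p) \<otimes>\<^bsub>D\<^esub> word_prod D (alternating s t (Suc k))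
         = v \<otimes>\<^bsub>D\<^esub> ((p \<otimes>\<^bsub>D\<^esub> p) \<otimes>\<^bsub>D\<^esub> word_prod D (alternating s t k))"
        using v pq alt by (simp add: m_assoc p_def)
      also have "\<dots> = w" using v pq alt by (simp add: gen_square)
      finally have "Suc k \<in> K" unfolding K_def using l v pq by (auto intro!: bexI[of _ "v \<otimes>\<^bsub>D\<^esub> p"])
      then show False using kS by blast
    qed
    have lq: "len (v \<otimes>\<^bsub>D\<^esub> q) > len v"
    proof -
      obtain j where j: "k = Suc j" using k1 by (cases k) auto
      then have "w = (v \<otimes>\<^bsub>D\<^esub> q) \<otimes>\<^bsub>D\<^esub> word_prod D (alternating s t j)"
        using v pq alt by (simp add: m_assoc q_def)
      then have "len w \<le> len (v \<otimes>\<^bsub>D\<^esub> q) + j" using len_mult_le[of "v \<otimes>\<^bsub>D\<^esub> q" "alternating s t j"] alt v pq by auto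
      then show ?thesis using v j by auto
    qed
    have lv: "len v < len w" using v k1 by simp
    have vs: "\<forall>r\<in>S. act D v (\<alpha> s) r \<ge> 0" and vt: "\<forall>r\<in>S. act D v (\<alpha> t) r \<ge> 0"
      using less(1)[OF lv v(1) pq(1) lp] less(1)[OF lv v(1) pq(2) lq] by (auto simp: p_def q_def split: if_splits)
    \<comment> \<open>If the peeled word had m letters or more, the braid relation would replace its
      last m letters, which end in \<open>t\<close>, by \<open>rev P\<close>, which ends in
      \<open>s\<close> because the alternating word of length \<open>2 * m\<close> starts with
      \<open>s\<close>. Then \<open>w s\<close> would be shorter than \<open>w\<close>.\<close>
    have km: "k + 1 \<le> m" if m: "cmat D s t = enat m" for m
    proof (rule ccontr)
      assume "\<not> ?thesis"
      then obtain j where j: "k = j + m" using le_Suc_ex[of m k] by (auto simp: add.commute)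
      have m2: "m \<ge> 2" using cmat_ge2[OF less(3) t(1) st] m by (simp add: numeral_eq_enat)
      obtain Q where Q: "length Q = j" "alternating s t k = Q @ alternating s t m"
        using alternating_add[of j s t m] j by auto
      obtain P where P: "length P = m" "alternating s t (2 * m) = P @ alternating s t m"
        using alternating_add[of m s t m] by (auto simp: mult_2)
      have PQ: "P \<in> lists S" "Q \<in> lists S" using alt[of k] alt[of "2*m"] P Q by auto
      obtain n where n: "2 * m = Suc n" "odd n" using m2 by (cases "2 * m") (simp, metis even_Suc even_mult_iff even_numeral)
      obtain P' where P': "P = s # P'" using P m2 n by (cases P) auto
      have PP: "P' \<in> lists S" "rev P' \<in> lists S" using PQ P' by auto
      have "word_prod D P \<otimes>\<^bsub>D\<^esub> word_prod D (alternating s t m) = \<one>\<^bsub>D\<^esub>"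
        using word_prod_relator[OF less(3) t(1) m] P PQ alt[of m] by (simp flip: alternating_even)
      moreover have c: "word_prod D (rev P) \<in> carrier D" "word_prod D P \<in> carrier D"
        "word_prod D (alternating s t m) \<in> carrier D"
        using PQ alt[of m] by (auto intro!: word_prod_closed)
      moreover have "word_prod D (rev P) \<otimes>\<^bsub>D\<^esub> word_prod D P = \<one>\<^bsub>D\<^esub>" by (rule word_prod_rev) (rule PQ)
      ultimately have "word_prod D (alternating s t m) = word_prod D (rev P)"
        by (metis inv_equality inv_inv)
      also have "\<dots> = word_prod D (rev P') \<otimes>\<^bsub>D\<^esub> s" using PP P' less sc by simp
      finally have "word_prod D (alternating s t m) \<otimes>\<^bsub>D\<^esub> s = word_prod D (rev P')"
        using PP less sc by (simp add: m_assoc gen_square)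
      moreover have "w \<otimes>\<^bsub>D\<^esub> s = v \<otimes>\<^bsub>D\<^esub> (word_prod D Q \<otimes>\<^bsub>D\<^esub> (word_prod D (alternating s t m) \<otimes>\<^bsub>D\<^esub> s))"
        using v Q PQ alt[of m] sc by (simp add: m_assoc)
      ultimately have "w \<otimes>\<^bsub>D\<^esub> s = v \<otimes>\<^bsub>D\<^esub> word_prod D (Q @ rev P')" using PQ PP by simp
      then have "len (w \<otimes>\<^bsub>D\<^esub> s) \<le> len v + (j + (m - 1))"
        using len_mult_le[of v "Q @ rev P'"] v PQ PP Q P P' by auto
      then show False using less(4) v j m2 by simp
    qed
    have co: "dihedral_coeff s t k \<ge> 0" "dihedral_coeff s t (k + 1) \<ge> 0"
      by (rule dihedral_coeff_nonneg[OF less(3) t(1) st]; use km in fastforce)+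
    have "act D w (\<alpha> s) = act D v (along (alternating s t k) (\<alpha> s))"
      using v alt by (simp add: act_mult_word)
    then show ?thesis using co vs vt
      by (auto simp: along_alternating[OF less(3) t(1) st] act_lin[OF v(1)] split: if_splits)
  qed
qed

text \<open>If \<open>w s\<close> is shorter than \<open>w\<close>, the previous lemma applies to
  \<open>w s\<close>, which sends \<alpha>_s to -\<beta>.\<close>

lemma root_sign:
  assumes "\<beta> \<in> roots D"
  shows "(\<forall>r\<in>S. \<beta> r \<ge> 0) \<or> (\<forall>r\<in>S. \<beta> r \<le> 0)"
proof -
  obtain w s where ws: "w \<in> carrier D" "s \<in> S" "\<beta> = act D w (\<alpha> s)" using assms by (auto simp: roots_def)
  have s: "s \<in> carrier D" using ws gens_carrier by auto
  show ?thesis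
  proof (cases "len (w \<otimes>\<^bsub>D\<^esub> s) > len w")
    case True
    then show ?thesis using act_simple_nonneg ws by blast
  next
    case False
    then have l: "len (w \<otimes>\<^bsub>D\<^esub> s) < len w" using len_mult_gen[OF ws(1,2)] by auto
    have e: "(w \<otimes>\<^bsub>D\<^esub> s) \<otimes>\<^bsub>D\<^esub> s = w" using ws s by (simp add: m_assoc gen_square)
    have "act D (w \<otimes>\<^bsub>D\<^esub> s) (\<alpha> s) = act D w (along [s] (\<alpha> s))" using act_mult_word[of w "[s]"] ws s by auto
    also have "\<dots> = act D w (\<lambda>r. (-1) * \<alpha> s r + 0 * \<alpha> s r)"
      using ws by (simp add: reflection_simple fun_Compl_def)
    also have "\<dots> = - \<beta>" unfolding act_lin[OF ws(1)] using ws(3) by (simp add: fun_Compl_def)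
    finally show ?thesis using act_simple_nonneg[of "w \<otimes>\<^bsub>D\<^esub> s" s] ws s e l by auto
  qed
qed

lemma roots_along: "\<beta> \<in> roots D \<longleftrightarrow> (\<exists>ss\<in>lists S. \<exists>s\<in>S. \<beta> = along ss (\<alpha> s))"
proof
  assume "\<beta> \<in> roots D"
  then obtain w s where ws: "w \<in> carrier D" "s \<in> S" "\<beta> = act D w (\<alpha> s)" unfolding roots_def by blast
  then show "\<exists>ss\<in>lists S. \<exists>s\<in>S. \<beta> = along ss (\<alpha> s)"
    using word_prod_surj[OF ws(1)] act_word_prod by metis
next
  assume "\<exists>ss\<in>lists S. \<exists>s\<in>S. \<beta> = along ss (\<alpha> s)"
  then obtain ss s where "ss \<in> lists S" "s \<in> S" "\<beta> = act D (word_prod D ss) (\<alpha> s)"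
    using act_word_prod by metis
  then show "\<beta> \<in> roots D" unfolding roots_def using word_prod_closed by blast
qed

lemma simple_root_in_roots: "s \<in> S \<Longrightarrow> \<alpha> s \<in> roots D"
  unfolding roots_along by (intro bexI[of _ "[]"] bexI[of _ s]) auto

lemma along_roots: "\<beta> \<in> roots D \<Longrightarrow> ss \<in> lists S \<Longrightarrow> along ss \<beta> \<in> roots D"
  unfolding roots_along by (metis append_in_lists_conv comp_apply foldr_append)

lemma uminus_roots: "\<beta> \<in> roots D \<Longrightarrow> - \<beta> \<in> roots D"
proof -
  assume "\<beta> \<in> roots D"
  then obtain ss s where "ss \<in> lists S" "s \<in> S" "\<beta> = along ss (\<alpha> s)" unfolding roots_along by blast
  then show ?thesis unfolding roots_along
    by (intro bexI[of _ "ss @ [s]"] bexI[of _ s]) (auto simp: reflection_simple along_uminus)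
qed

lemma root_bform: "\<beta> \<in> roots D \<Longrightarrow> bform D \<beta> \<beta> = 2"
  unfolding roots_along using bform_along bform_simple2 gram_self by metis

lemma root_outside: "\<beta> \<in> roots D \<Longrightarrow> r \<notin> S \<Longrightarrow> \<beta> r = 0"
proof -
  assume "\<beta> \<in> roots D" and r: "r \<notin> S"
  then obtain ss s where "ss \<in> lists S" "s \<in> S" "\<beta> = along ss (\<alpha> s)" unfolding roots_along by blast
  then show ?thesis using r by (subst \<open>\<beta> = _\<close>, subst along_other) (auto simp: simple_root_def)
qed

lemma root_nonzero: "\<beta> \<in> roots D \<Longrightarrow> \<exists>r\<in>S. \<beta> r \<noteq> 0"
proof (rule ccontr)
  assume "\<beta> \<in> roots D" "\<not> (\<exists>r\<in>S. \<beta> r \<noteq> 0)"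
  then show False using root_bform[of \<beta>] by (simp add: bform_gram)
qed

lemma root_pos_neg: "\<beta> \<in> roots D \<Longrightarrow> pos_root D \<beta> \<longleftrightarrow> \<not> neg_root D \<beta>"
  using root_sign[of \<beta>] root_nonzero[of \<beta>] unfolding pos_root_def neg_root_def
  by (metis order_antisym)

lemma neg_uminus: "neg_root D (- \<beta>) \<longleftrightarrow> pos_root D \<beta>"
  using uminus_roots[of \<beta>] uminus_roots[of "- \<beta>"] by (auto simp: pos_root_def neg_root_def fun_Compl_def)

lemma pos_simple: "s \<in> S \<Longrightarrow> pos_root D (\<alpha> s)"
  unfolding pos_root_def using simple_root_in_roots by (auto simp: simple_root_def)

text \<open>The reflection changes only the coordinate at s, so every other coordinate is both
  nonnegative and nonpositive. What remains is a multiple of \<alpha>_s, and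
  \<open>root_bform\<close> makes the factor 1.\<close>

lemma reflection_makes_negative:
  assumes "pos_root D \<beta>" "s \<in> S" "neg_root D (reflection D s \<beta>)"
  shows "\<beta> = \<alpha> s"
proof -
  have b: "\<beta> \<in> roots D" using assms by (simp add: pos_root_def)
  have z: "\<beta> r = 0" if "r \<noteq> s" for r
    using that assms root_outside[OF b] reflection_other[OF that, of \<beta>]
    unfolding pos_root_def neg_root_def by (metis order_antisym)
  have eq: "\<beta> = (\<lambda>r. \<beta> s * \<alpha> s r + 0 * \<alpha> s r)" using z by (auto simp: simple_root_def fun_eq_iff)
  have "bform D \<beta> \<beta> = \<beta> s * bform D \<beta> (\<alpha> s)" by (subst (2) eq, subst bform_lin) simp
  also have "bform D \<beta> (\<alpha> s) = \<beta> s * bform D (\<alpha> s) (\<alpha> s)"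
    by (subst bform_sym, subst eq, subst bform_lin) simp
  finally have "(\<beta> s)\<^sup>2 = 1" using root_bform[OF b] assms(2)
    by (simp add: bform_simple2 gram_self power2_eq_square)
  moreover have "\<beta> s \<ge> 0" using assms by (simp add: pos_root_def)
  ultimately have "\<beta> s = 1" by (simp add: power2_eq_1_iff)
  then show ?thesis using z by (auto simp: simple_root_def fun_eq_iff)
qed

end

section \<open>The orientation given by a Coxeter element\<close>

locale coxeter_quiver = coxeter D for D :: "('g, 'v) coxeter_datum" +
  fixes c :: 'g
  assumes coxeter_element: "coxeter_element D c"
begin

abbreviation "V \<equiv> verts D"
abbreviation "E \<equiv> edges D"
abbreviation "A \<equiv> arrows D c"

lemma finite_verts: "finite V" and rho_gens: "x \<in> V \<Longrightarrow> rho D x \<in> S"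
  and rho_eq_iff: "x \<in> V \<Longrightarrow> y \<in> V \<Longrightarrow> rho D x = rho D y \<longleftrightarrow> x = y"
  using rho_bij finite_gens bij_betw_finite[OF rho_bij]
  by (auto simp: bij_betw_def inj_on_eq_iff)

lemma edges_sym: "(x, y) \<in> E \<Longrightarrow> (y, x) \<in> E"
  using cmat_sym rho_gens by (auto simp: edges_def)

lemma edges_verts: "(x, y) \<in> E \<Longrightarrow> x \<in> V \<and> y \<in> V \<and> x \<noteq> y"
  by (auto simp: edges_def)

text \<open>A linear extension of the quiver: arrows go up in \<open>position\<close>. It provides
  acyclicity and the choice of maximal vertices.\<close>

definition position :: "'v \<Rightarrow> nat" where
  "position x = (THE i. i < length (SOME cs. coxeter_word D c cs) \<and> (SOME cs. coxeter_word D c cs) ! i = rho D x)"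

lemma coxeter_word_expr:
  defines "cs \<equiv> (SOME cs. coxeter_word D c cs)"
  shows "distinct cs" "set cs = S"
proof -
  have "coxeter_word D c cs"
    unfolding cs_def using coxeter_element by (auto simp: coxeter_element_def intro: someI_ex)
  then show "distinct cs" "set cs = S" by (auto simp: coxeter_word_def)
qed

lemma position_iff:
  defines "cs \<equiv> (SOME cs. coxeter_word D c cs)"
  assumes x: "x \<in> V"
  shows "i < length cs \<and> cs ! i = rho D x \<longleftrightarrow> i = position x"
proof -
  note cs = coxeter_word_expr[folded cs_def]
  obtain i0 where i0: "i0 < length cs" "cs ! i0 = rho D x"
    using rho_gens[OF x] cs(2) by (metis in_set_conv_nth)
  have unique: "i = i0" if "i < length cs" "cs ! i = rho D x" for i
    using that i0 nth_eq_iff_index_eq[OF cs(1) that(1) i0(1)] by simp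
  have "position x = i0" unfolding position_def cs_def[symmetric]
    by (rule the_equality) (use i0 unique in blast)+
  then show ?thesis using i0 unique by blast
qed

lemma arrows_iff: "(x, y) \<in> A \<longleftrightarrow> (x, y) \<in> E \<and> position x < position y"
proof (cases "(x, y) \<in> E")
  case True
  let ?cs = "SOME cs. coxeter_word D c cs"
  have "(x, y) \<in> A \<longleftrightarrow> (\<exists>i j. i < j \<and> (i < length ?cs \<and> ?cs ! i = rho D x) \<and> (j < length ?cs \<and> ?cs ! j = rho D y))"
    unfolding arrows_def word_orientation_def using True by (auto intro: less_trans)
  then show ?thesis using True edges_verts[OF True] by (simp add: position_iff)
next
  case False
  then show ?thesis by (simp add: arrows_def word_orientation_def)
qed

lemma arrows_edges: "(x, y) \<in> A \<Longrightarrow> (x, y) \<in> E \<and> (y, x) \<in> E"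
  by (auto simp: arrows_iff edges_sym)

lemma position_neq: "(x, y) \<in> E \<Longrightarrow> position x \<noteq> position y"
  using position_iff[of x "position x"] position_iff[of y "position y"] edges_verts[of x y] rho_eq_iff[of x y]
  by auto

lemma arrows_total: "(x, y) \<in> E \<Longrightarrow> (y, x) \<in> A \<longleftrightarrow> (x, y) \<notin> A"
  using position_neq[of x y] edges_sym[of x y] edges_sym[of y x] by (auto simp: arrows_iff)

section \<open>Admissible words as functions counting letters\<close>

text \<open>A vertex becomes a sink again only after each of its neighbours has been reversed once,
  so the letters at the two ends of an edge alternate; the head of an arrow comes first.\<close>

definition adm :: "('v \<Rightarrow> nat) \<Rightarrow> bool" where
  "adm f \<longleftrightarrow> (\<forall>v. v \<notin> V \<longrightarrow> f v = 0) \<and> (\<forall>a b. (a, b) \<in> A \<longrightarrow> f a \<le> f b \<and> f b \<le> Suc (f a))"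

definition bump :: "('v \<Rightarrow> nat) \<Rightarrow> 'v \<Rightarrow> 'v \<Rightarrow> nat" where
  "bump f x = f(x := Suc (f x))"

definition addable :: "('v \<Rightarrow> nat) \<Rightarrow> 'v \<Rightarrow> bool" where
  "addable f x \<longleftrightarrow> adm f \<and> x \<in> V \<and> (\<forall>w. (x, w) \<in> E \<longrightarrow> f w = f x + of_bool ((x, w) \<in> A))"

text \<open>Reversals at the two ends of an edge cancel, so the orientation reached depends on the
  counts only: an edge starts at the end with more reversals and has its original direction in a
  tie.\<close>

definition reorient :: "('v \<Rightarrow> nat) \<Rightarrow> 'v rel" where
  "reorient f = {(a, b) \<in> E. f b < f a \<or> (f a = f b \<and> (a, b) \<in> A)}"

fun walk :: "('v \<Rightarrow> nat) \<Rightarrow> 'v list \<Rightarrow> bool" where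
  "walk f [] \<longleftrightarrow> True"
| "walk f (x # xs) \<longleftrightarrow> addable f x \<and> walk (bump f x) xs"

definition bumps :: "('v \<Rightarrow> nat) \<Rightarrow> 'v list \<Rightarrow> 'v \<Rightarrow> nat" where
  "bumps f xs = (\<lambda>v. f v + count_list xs v)"

lemma bumps_simps [simp]: "bumps f [] = f" "bumps f (x # xs) = bumps (bump f x) xs"
  "bumps f (xs @ ys) = bumps (bumps f xs) ys"
  by (auto simp: bumps_def bump_def fun_eq_iff)

lemma bumps_apply: "bumps f xs v = f v + count_list xs v"
  by (simp add: bumps_def)

lemma bumps_ge: "f v \<le> bumps f xs v" by (simp add: bumps_apply)

lemma bump_apply: "bump f x v = f v + of_bool (v = x)"
  by (simp add: bump_def)

lemma adm_zero: "adm (\<lambda>_. 0)" by (simp add: adm_def)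

lemma adm_arrow: "adm f \<Longrightarrow> (a, b) \<in> A \<Longrightarrow> f a \<le> f b \<and> f b \<le> Suc (f a)"
  by (simp add: adm_def)

lemma adm_outside: "adm f \<Longrightarrow> v \<notin> V \<Longrightarrow> f v = 0"
  by (simp add: adm_def)

lemma addable_adm: "addable f x \<Longrightarrow> adm f" and addable_verts: "addable f x \<Longrightarrow> x \<in> V"
  by (simp_all add: addable_def)

lemma addable_edge: "addable f x \<Longrightarrow> (x, w) \<in> E \<Longrightarrow> f w = f x + of_bool ((x, w) \<in> A)"
  by (simp add: addable_def)

lemma adm_bump:
  assumes "addable f x" shows "adm (bump f x)"
  unfolding adm_def
proof (intro conjI allI impI)
  show "bump f x v = 0" if "v \<notin> V" for v
    using that assms by (auto simp: bump_apply addable_def adm_def)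
  fix a b assume ab: "(a, b) \<in> A"
  then have e: "(a, b) \<in> E" "(b, a) \<in> E" "a \<noteq> b" "(b, a) \<notin> A"
    using arrows_edges edges_verts arrows_total by blast+
  have f: "f a \<le> f b \<and> f b \<le> Suc (f a)" using assms ab by (auto simp: addable_def adm_def)
  have "bump f x a \<le> bump f x b \<and> bump f x b \<le> Suc (bump f x a)"
  proof (cases "x = a")
    case True
    then show ?thesis using e ab addable_edge[OF assms, of b] by (simp add: bump_apply)
  next
    case xa: False
    show ?thesis
    proof (cases "x = b")
      case True
      then show ?thesis using e addable_edge[OF assms, of a] by (simp add: bump_apply)
    next
      case False
      then show ?thesis using f xa by (simp add: bump_apply)
    qed
  qed
  then show "bump f x a \<le> bump f x b" "bump f x b \<le> Suc (bump f x a)" by auto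
qed

lemma addableI:
  assumes "adm f" "x \<in> V" "adm (bump f x)"
  shows "addable f x"
  unfolding addable_def
proof (intro conjI assms allI impI)
  fix w assume e: "(x, w) \<in> E"
  then have "w \<noteq> x" using edges_verts by blast
  then show "f w = f x + of_bool ((x, w) \<in> A)"
    using arrows_total[OF e] adm_arrow[OF assms(1), of x w] adm_arrow[OF assms(1), of w x]
      adm_arrow[OF assms(3), of x w] adm_arrow[OF assms(3), of w x]
    by (cases "(x, w) \<in> A") (auto simp: bump_apply)
qed

lemma reorient_zero: "reorient (\<lambda>_. 0) = A"
  using arrows_edges by (auto simp: reorient_def)

lemma sink_iff:
  assumes "adm f" shows "sink D (reorient f) x \<longleftrightarrow> addable f x"
proof -
  have "(x, w) \<notin> reorient f \<longleftrightarrow> ((x, w) \<in> E \<longrightarrow> f w = f x + of_bool ((x, w) \<in> A))" for w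
  proof (cases "(x, w) \<in> E")
    case E: True
    show ?thesis
    proof (cases "(x, w) \<in> A")
      case True
      then show ?thesis using E adm_arrow[OF assms True] by (simp add: reorient_def) linarith
    next
      case False
      then have "(w, x) \<in> A" using arrows_total[OF E] by blast
      from adm_arrow[OF assms this] show ?thesis using E False by (simp add: reorient_def) linarith
    qed
  qed (simp add: reorient_def)
  then show ?thesis using assms by (auto simp: sink_def addable_def)
qed

lemma reverse_at_reorient:
  assumes "addable f x" shows "reverse_at x (reorient f) = reorient (bump f x)"
proof -
  have "(a, b) \<in> reverse_at x (reorient f) \<longleftrightarrow> (a, b) \<in> reorient (bump f x)" for a b
  proof (cases "(a, b) \<in> E")
    case True
    then have e: "(b, a) \<in> E" "a \<noteq> b" "(b, a) \<in> A \<longleftrightarrow> (a, b) \<notin> A"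
      using edges_sym edges_verts arrows_total by blast+
    consider "x = a" | "x = b" | "x \<noteq> a" "x \<noteq> b" by blast
    then show ?thesis
    proof cases
      case 1
      then show ?thesis using True e addable_edge[OF assms, of b]
        by (simp add: reverse_at_def reorient_def bump_apply)
    next
      case 2
      then show ?thesis using True e addable_edge[OF assms, of a]
        by (simp add: reverse_at_def reorient_def bump_apply)
    next
      case 3
      then show ?thesis using True e by (simp add: reverse_at_def reorient_def bump_apply)
    qed
  next
    case False
    then show ?thesis using edges_sym[of b a] by (auto simp: reverse_at_def reorient_def)
  qed
  then show ?thesis by auto
qed

lemma sink_sequence_iff: "adm f \<Longrightarrow> sink_sequence D (reorient f) xs \<longleftrightarrow> walk f xs"
  by (induction xs arbitrary: f) (auto simp: sink_iff reverse_at_reorient adm_bump)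

lemma walk_append [simp]: "walk f (xs @ ys) \<longleftrightarrow> walk f xs \<and> walk (bumps f xs) ys"
  by (induction xs arbitrary: f) auto

lemma walk_adm: "adm f \<Longrightarrow> walk f xs \<Longrightarrow> adm (bumps f xs)"
  by (induction xs arbitrary: f) (auto simp: adm_bump)

lemma walk_verts: "walk f xs \<Longrightarrow> xs \<in> lists V"
  by (induction xs arbitrary: f) (auto simp: addable_verts)

lemma addable_bump_nonadjacent:
  assumes "addable f x" "y \<noteq> x" "(x, y) \<notin> E"
  shows "addable (bump f x) y \<longleftrightarrow> addable f y"
  using assms adm_bump[OF assms(1)] edges_sym[of y x] by (auto simp: addable_def bump_apply)

text \<open>Among the vertices still below \<open>g\<close> take those with the smallest value of
  \<open>f\<close>, and among these the one latest in \<open>position\<close>. It is a sink: a tied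
  head of one of its arrows would be a later candidate, and a lagging tail of an arrow into it would
  be a candidate with a smaller value.\<close>

lemma walk_extend:
  assumes "adm f" "adm g" "f \<le> g"
  shows "\<exists>xs. walk f xs \<and> bumps f xs = g"
  using assms
proof (induction "\<Sum>v\<in>V. g v - f v" arbitrary: f rule: less_induct)
  case less
  define M where "M = {v. f v < g v}"
  have MV: "M \<subseteq> V"
  proof
    show "v \<in> V" if "v \<in> M" for v
      using that adm_outside[OF less(3), of v] by (cases "v \<in> V") (auto simp: M_def)
  qed
  show ?case
  proof (cases "M = {}")
    case True
    then have "g \<le> f" unfolding M_def le_fun_def by (simp add: not_less)
    then have "f = g" using less(4) by simp
    then show ?thesis by (intro exI[of _ "[]"]) auto
  next
    case False
    have fM: "finite M" using MV finite_verts finite_subset by blast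
    define m where "m = Min (f ` M)"
    have m: "m \<in> f ` M" "\<And>v. v \<in> M \<Longrightarrow> m \<le> f v" unfolding m_def using fM False by auto
    define M' where "M' = {v \<in> M. f v = m}"
    have M': "finite M'" "M' \<noteq> {}" using fM m(1) by (auto simp: M'_def)
    have "Max (position ` M') \<in> position ` M'" using M' by (intro Max_in) auto
    then obtain y where y: "y \<in> M'" "position y = Max (position ` M')" by auto
    have ymax: "position v \<le> position y" if "v \<in> M'" for v using that M' by (simp add: y)
    have yM: "y \<in> M" "f y = m" "y \<in> V" using y(1) MV by (auto simp: M'_def)
    have ad: "addable f y" unfolding addable_def
    proof (intro conjI allI impI less yM)
      fix w assume e: "(y, w) \<in> E"
      show "f w = f y + of_bool ((y, w) \<in> A)"
      proof (cases "(y, w) \<in> A")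
        case True
        have "f w \<noteq> f y"
        proof
          assume eq: "f w = f y"
          have "w \<in> M" using adm_arrow[OF less(3) True] yM eq by (auto simp: M_def)
          then have "w \<in> M'" using eq yM by (auto simp: M'_def)
          then show False using ymax True by (force simp: arrows_iff)
        qed
        then show ?thesis using True adm_arrow[OF less(2) True] by auto
      next
        case False
        then have wy: "(w, y) \<in> A" using arrows_total[OF e] by auto
        have "\<not> f w < f y"
        proof
          assume lt: "f w < f y"
          then have "w \<in> M" using adm_arrow[OF less(3) wy] yM by (auto simp: M_def)
          then show False using m(2) lt yM by force
        qed
        then show ?thesis using False adm_arrow[OF less(2) wy] by auto
      qed
    qed
    have le: "bump f y \<le> g" using less(4) yM by (auto simp: le_fun_def bump_apply M_def)
    have "(\<Sum>v\<in>V. g v - bump f y v) < (\<Sum>v\<in>V. g v - f v)"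
      using yM finite_verts by (intro sum_strict_mono_ex1) (auto simp: bump_apply M_def intro!: bexI[of _ y])
    then obtain xs where "walk (bump f y) xs" "bumps (bump f y) xs = g"
      using less(1)[OF _ adm_bump[OF ad] less(3) le] by blast
    then show ?thesis using ad by (intro exI[of _ "y # xs"]) auto
  qed
qed

section \<open>Congruence of words and independence of the path\<close>

lemma graph_cong_equiv: "equiv (lists V) (graph_cong D)"
proof (rule equivI)
  have "u \<in> lists V \<and> v \<in> lists V" if "(u, v) \<in> graph_cong D" for u v
    using that unfolding graph_cong_def by (induction rule: word_cong.induct) auto
  then show "graph_cong D \<subseteq> lists V \<times> lists V" by auto
  then show "refl_on (lists V) (graph_cong D)"
    by (auto simp: refl_on_def graph_cong_def intro: word_cong.refl)
  show "sym (graph_cong D)" by (auto simp: sym_def graph_cong_def intro: word_cong.sym)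
  show "trans (graph_cong D)" unfolding trans_def graph_cong_def using word_cong.trans by blast
qed

lemma graph_cong_lists: "(u, v) \<in> graph_cong D \<Longrightarrow> u \<in> lists V \<and> v \<in> lists V"
  using equiv_type[OF graph_cong_equiv] by auto

lemma graph_cong_refl: "u \<in> lists V \<Longrightarrow> (u, u) \<in> graph_cong D"
  and graph_cong_sym: "(u, v) \<in> graph_cong D \<Longrightarrow> (v, u) \<in> graph_cong D"
  and graph_cong_trans: "(u, v) \<in> graph_cong D \<Longrightarrow> (v, w) \<in> graph_cong D \<Longrightarrow> (u, w) \<in> graph_cong D"
  and graph_cong_append: "(u, v) \<in> graph_cong D \<Longrightarrow> (u', v') \<in> graph_cong D \<Longrightarrow> (u @ u', v @ v') \<in> graph_cong D"
  unfolding graph_cong_def by (auto intro: word_cong.intros)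

lemma graph_cong_swap:
  "x \<in> V \<Longrightarrow> y \<in> V \<Longrightarrow> x \<noteq> y \<Longrightarrow> (x, y) \<notin> E \<Longrightarrow> ([x, y], [y, x]) \<in> graph_cong D"
  unfolding graph_cong_def by (rule word_cong.gen) auto

lemma addable_not_adjacent: "addable f x \<Longrightarrow> addable f y \<Longrightarrow> (x, y) \<notin> E"
  using addable_edge[of f x y] addable_edge[of f y x] arrows_total[of x y] edges_sym[of x y] by auto

text \<open>A diamond argument. Different first letters x and y are both sinks, hence not adjacent,
  so each stays available after the other. \<open>walk_extend\<close> completes both orders by the
  same \<open>zs\<close>, and the induction hypothesis compares each given word with its
  completion.\<close>

lemma walk_path_cong:
  assumes "adm f" "walk f xs" "walk f ys" "bumps f xs = bumps f ys"
  shows "(rev xs, rev ys) \<in> graph_cong D"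
  using assms
proof (induction "length xs" arbitrary: f xs ys rule: less_induct)
  case less
  have cnt: "count_list xs v = count_list ys v" for v using fun_cong[OF less(5), of v] by (simp add: bumps_apply)
  then have m: "mset xs = mset ys" by (simp add: multiset_eq_iff count_mset)
  show ?case
  proof (cases xs)
    case Nil
    then show ?thesis using m by (auto intro: graph_cong_refl)
  next
    case (Cons x xs')
    then obtain y ys' where ys: "ys = y # ys'" using m by (cases ys) auto
    have len: "length ys' = length xs'" using m Cons ys mset_eq_length by fastforce
    have x: "addable f x" "walk (bump f x) xs'" "x \<in> V" and y: "addable f y" "walk (bump f y) ys'" "y \<in> V"
      using less Cons ys addable_verts by auto
    show ?thesis
    proof (cases "x = y")
      case True
      then have "(rev xs', rev ys') \<in> graph_cong D"
        using less(1)[of xs' "bump f x" ys'] adm_bump[OF x(1)] x y less(5) Cons ys by auto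
      then show ?thesis using True Cons ys x graph_cong_append[OF _ graph_cong_refl, of _ _ "[x]"] by auto
    next
      case False
      have na: "(x, y) \<notin> E" by (rule addable_not_adjacent[OF x(1) y(1)])
      have ax: "addable (bump f x) y" using addable_bump_nonadjacent[OF x(1), of y] False na y by auto
      have ay: "addable (bump f y) x"
        using addable_bump_nonadjacent[OF y(1), of x] False na x edges_sym by auto
      have comm: "bump (bump f x) y = bump (bump f y) x" using False by (auto simp: bump_def fun_eq_iff)
      have le: "bump (bump f x) y \<le> bumps f xs"
      proof (rule le_funI)
        fix v
        have "y \<in> set xs'" using False m Cons ys by (metis list.set_intros(1) mset_eq_setD set_ConsD)
        then have "count_list xs' y \<ge> 1" by (metis One_nat_def Suc_leI count_list_0_iff gr0I)
        then show "bump (bump f x) y v \<le> bumps f xs v"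
          unfolding Cons by (auto simp: bumps_apply bump_apply)
      qed
      have "adm (bumps f xs)" using less walk_adm by blast
      then obtain zs where zs: "walk (bump (bump f x) y) zs" "bumps (bump (bump f x) y) zs = bumps f xs"
        using walk_extend[OF adm_bump[OF ax] _ le] by blast
      have 1: "(rev xs', rev (y # zs)) \<in> graph_cong D"
        using less(1)[of xs' "bump f x" "y # zs"] x ax zs adm_bump[OF x(1)] Cons by auto
      have 2: "(rev ys', rev (x # zs)) \<in> graph_cong D"
        using less(1)[of ys' "bump f y" "x # zs"] y ay zs adm_bump[OF y(1)] Cons ys len less(5) comm by auto
      have z: "rev zs \<in> lists V" using walk_verts[OF zs(1)] by (auto simp: in_lists_conv_set)
      have "(rev xs, rev zs @ [y, x]) \<in> graph_cong D"
        using graph_cong_append[OF 1 graph_cong_refl[of "[x]"]] x Cons by auto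
      moreover have "(rev zs @ [y, x], rev zs @ [x, y]) \<in> graph_cong D"
        using graph_cong_append[OF graph_cong_refl[OF z] graph_cong_swap[of y x]] x y False na edges_sym by blast
      moreover have "(rev ys, rev zs @ [x, y]) \<in> graph_cong D"
        using graph_cong_append[OF 2 graph_cong_refl[of "[y]"]] y ys by auto
      ultimately show ?thesis using graph_cong_sym graph_cong_trans by meson
    qed
  qed
qed

lemma rho_lists: "us \<in> lists V \<Longrightarrow> map (rho D) us \<in> lists S"
  using rho_gens by (auto simp: in_lists_conv_set)

lemma gens_commute:
  assumes "v \<in> V" "w \<in> V" "v \<noteq> w" "(v, w) \<notin> E"
  shows "rho D v \<otimes>\<^bsub>D\<^esub> rho D w = rho D w \<otimes>\<^bsub>D\<^esub> rho D v"
proof -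
  let ?s = "rho D v" and ?t = "rho D w"
  have st: "?s \<in> S" "?t \<in> S" "?s \<noteq> ?t" "?s \<in> carrier D" "?t \<in> carrier D"
    using assms rho_gens rho_eq_iff gens_carrier by blast+
  have "cmat D ?s ?t = 2" using cmat_ge2[OF st(1-3)] assms by (auto simp: edges_def)
  then have "word_prod D (concat (replicate 2 [?s, ?t])) = \<one>\<^bsub>D\<^esub>"
    using st by (intro word_prod_relator) (auto simp: numeral_eq_enat)
  then have "(?s \<otimes>\<^bsub>D\<^esub> ?t) \<otimes>\<^bsub>D\<^esub> (?s \<otimes>\<^bsub>D\<^esub> ?t) = \<one>\<^bsub>D\<^esub>" using st by (simp add: numeral_2_eq_2 m_assoc)
  moreover have "(?s \<otimes>\<^bsub>D\<^esub> ?t) \<otimes>\<^bsub>D\<^esub> (?t \<otimes>\<^bsub>D\<^esub> ?s) = ?s \<otimes>\<^bsub>D\<^esub> ((?t \<otimes>\<^bsub>D\<^esub> ?t) \<otimes>\<^bsub>D\<^esub> ?s)" using st by (simp add: m_assoc)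
  ultimately show ?thesis using st by (metis gen_square Units_eq Units_l_cancel l_one m_closed r_one)
qed

text \<open>Everything that has to be well defined on classes is proved in one induction, because
  the product case for walks needs the equality of letter counts.\<close>

lemma graph_cong_invariants:
  assumes "(us, vs) \<in> graph_cong D"
  shows "mset us = mset vs" "adm f \<Longrightarrow> walk f (rev us) \<longleftrightarrow> walk f (rev vs)"
    "word_prod D (map (rho D) us) = word_prod D (map (rho D) vs)" "(rev us, rev vs) \<in> graph_cong D"
proof -
  have "us \<in> lists V \<and> vs \<in> lists V \<and> mset us = mset vs \<and> (\<forall>f. adm f \<longrightarrow> walk f (rev us) \<longleftrightarrow> walk f (rev vs)) \<and>
     word_prod D (map (rho D) us) = word_prod D (map (rho D) vs) \<and> (rev us, rev vs) \<in> graph_cong D"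
    using assms unfolding graph_cong_def
  proof (induction rule: word_cong.induct)
    case (gen u v)
    then obtain x y where xy: "u = [x, y]" "v = [y, x]" "x \<in> V" "y \<in> V" "x \<noteq> y" "(x, y) \<notin> E" by blast
    have "(y, x) \<notin> E" using xy edges_sym by blast
    moreover have "rho D x \<in> carrier D" "rho D y \<in> carrier D" using xy rho_gens gens_carrier by blast+
    ultimately show ?case using xy graph_cong_swap[of y x] gens_commute[of x y]
      addable_bump_nonadjacent[of _ x y] addable_bump_nonadjacent[of _ y x]
      by (auto simp: graph_cong_def)
  next
    case (refl u)
    then show ?case by (auto intro!: word_cong.refl simp: in_lists_conv_set)
  next
    case (sym u v)
    then show ?case by (auto intro: word_cong.sym)
  next
    case (trans u v w)
    then show ?case by (auto intro: word_cong.trans)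
  next
    case (mult u v u' v')
    have "bumps f (rev u') = bumps f (rev v')" for f
      using mult.IH by (auto simp: bumps_def fun_eq_iff simp flip: count_mset)
    then show ?case using mult.IH rho_lists by (auto intro: word_cong.mult simp: walk_adm)
  qed
  then show "mset us = mset vs" "adm f \<Longrightarrow> walk f (rev us) \<longleftrightarrow> walk f (rev vs)"
    "word_prod D (map (rho D) us) = word_prod D (map (rho D) vs)" "(rev us, rev vs) \<in> graph_cong D" by blast+
qed

section \<open>Transport of roots along admissible words\<close>

abbreviation "vroot x \<equiv> \<alpha> (rho D x)"
abbreviation "null \<equiv> (\<lambda>_. 0) :: 'v \<Rightarrow> nat"

definition apply_word :: "'v list \<Rightarrow> ('g \<Rightarrow> real) \<Rightarrow> 'g \<Rightarrow> real" where
  "apply_word xs = fold (\<lambda>x. reflection D (rho D x)) xs"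

text \<open>The choice does not matter: admissible words with the same counts are congruent by
  \<open>walk_path_cong\<close>, so they act in the same way.\<close>

definition word_of :: "('v \<Rightarrow> nat) \<Rightarrow> 'v list" where
  "word_of f = (SOME xs. walk null xs \<and> bumps null xs = f)"

definition transport :: "('v \<Rightarrow> nat) \<Rightarrow> ('g \<Rightarrow> real) \<Rightarrow> 'g \<Rightarrow> real" where
  "transport f = apply_word (word_of f)"

definition inv_transport :: "('v \<Rightarrow> nat) \<Rightarrow> ('g \<Rightarrow> real) \<Rightarrow> 'g \<Rightarrow> real" where
  "inv_transport f = apply_word (rev (word_of f))"

lemma apply_word_simps [simp]: "apply_word [] v = v"
  "apply_word (x # xs) v = apply_word xs (reflection D (rho D x) v)"
  "apply_word (xs @ ys) v = apply_word ys (apply_word xs v)"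
  by (simp_all add: apply_word_def)

lemma apply_word_along: "apply_word xs v = along (map (rho D) (rev xs)) v"
  by (induction xs arbitrary: v) auto

lemma rev_lists: "xs \<in> lists X \<Longrightarrow> rev xs \<in> lists X"
  by (auto simp: in_lists_conv_set)

lemma apply_word_rev: "xs \<in> lists V \<Longrightarrow> apply_word (rev xs) (apply_word xs v) = v"
  using along_rev[of "map (rho D) (rev xs)" v] rho_lists[OF rev_lists, of xs]
  by (simp add: apply_word_along rev_map)

lemma apply_word_roots: "xs \<in> lists V \<Longrightarrow> \<beta> \<in> roots D \<Longrightarrow> apply_word xs \<beta> \<in> roots D"
  using along_roots rho_lists[OF rev_lists, of xs] by (auto simp: apply_word_along)

lemma word_of:
  assumes "adm f" shows "walk null (word_of f)" "bumps null (word_of f) = f" "word_of f \<in> lists V"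
proof -
  have "\<exists>xs. walk null xs \<and> bumps null xs = f"
    using walk_extend[OF adm_zero assms] by (simp add: le_fun_def)
  then have "walk null (word_of f) \<and> bumps null (word_of f) = f"
    unfolding word_of_def by (rule someI_ex)
  then show "walk null (word_of f)" "bumps null (word_of f) = f" "word_of f \<in> lists V"
    using walk_verts by blast+
qed

lemma walk_apply_word:
  assumes "adm f" "walk f xs" "walk f ys" "bumps f xs = bumps f ys"
  shows "apply_word xs v = apply_word ys v"
proof -
  have g: "(rev xs, rev ys) \<in> graph_cong D" by (rule walk_path_cong[OF assms])
  then have "rev xs \<in> lists V" "rev ys \<in> lists V" using graph_cong_lists by blast+
  then show ?thesis using graph_cong_invariants(3)[OF g] along_cong(1) rho_lists
    unfolding apply_word_along by blast
qed

lemma transport_walk: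
  assumes "adm f" "walk f xs"
  shows "transport (bumps f xs) v = apply_word xs (transport f v)"
proof -
  have "transport (bumps f xs) v = apply_word (word_of f @ xs) v"
    unfolding transport_def using assms walk_adm[OF assms] word_of[OF assms(1)] word_of[OF walk_adm[OF assms]]
    by (intro walk_apply_word[OF adm_zero]) auto
  then show ?thesis by (simp add: transport_def)
qed

lemma transport_zero: "transport null v = v"
  using walk_apply_word[OF adm_zero word_of(1)[OF adm_zero], of "[]"] word_of(2)[OF adm_zero]
  by (simp add: transport_def)

lemma transport_bump: "addable f x \<Longrightarrow> transport (bump f x) v = reflection D (rho D x) (transport f v)"
  using transport_walk[of f "[x]"] by (simp add: addable_adm)

lemma inv_transport_trans: "adm f \<Longrightarrow> inv_transport f (transport f v) = v"
  and transport_inv_transport: "adm f \<Longrightarrow> transport f (inv_transport f v) = v"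
  using apply_word_rev[OF word_of(3)] apply_word_rev[OF rev_lists[OF word_of(3)]]
  by (simp_all add: transport_def inv_transport_def)

lemma transport_roots: "adm f \<Longrightarrow> \<beta> \<in> roots D \<Longrightarrow> transport f \<beta> \<in> roots D"
  and inv_transport_roots: "adm f \<Longrightarrow> \<beta> \<in> roots D \<Longrightarrow> inv_transport f \<beta> \<in> roots D"
  unfolding transport_def inv_transport_def
  by (rule apply_word_roots[OF word_of(3)]; assumption) (rule apply_word_roots[OF rev_lists[OF word_of(3)]]; assumption)

lemma transport_uminus: "transport f (- v) = - transport f v"
  by (simp add: transport_def apply_word_along along_uminus)

lemma root_in_roots: "x \<in> V \<Longrightarrow> vroot x \<in> roots D"
  using simple_root_in_roots rho_gens by blast

lemma inv_transport_eqI: "adm f \<Longrightarrow> transport f v = w \<Longrightarrow> inv_transport f w = v"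
  using inv_transport_trans by blast

lemma reflection_nonadjacent:
  assumes "x \<in> V" "y \<in> V" "y \<noteq> x" "(x, y) \<notin> E"
  shows "reflection D (rho D y) (vroot x) = vroot x"
proof -
  have "\<not> cmat D (rho D y) (rho D x) > 2" using assms cmat_sym rho_gens by (auto simp: edges_def)
  then have "gram (rho D y) (rho D x) = 0"
    using gram_eq_0_iff[of "rho D y" "rho D x"] assms rho_gens rho_eq_iff by metis
  then show ?thesis using assms rho_gens by (simp add: reflection_def bform_simple2)
qed

lemma adm_min:
  assumes "adm f" "adm g" shows "adm (\<lambda>v. min (f v) (g v))"
  unfolding adm_def
proof (intro conjI allI impI)
  fix a b assume "(a, b) \<in> A"
  from adm_arrow[OF assms(1) this] adm_arrow[OF assms(2) this]
  show "min (f a) (g a) \<le> min (f b) (g b)" "min (f b) (g b) \<le> Suc (min (f a) (g a))" by auto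
qed (simp add: adm_outside assms)

lemma adm_max:
  assumes "adm f" "adm g" shows "adm (\<lambda>v. max (f v) (g v))"
  unfolding adm_def
proof (intro conjI allI impI)
  fix a b assume "(a, b) \<in> A"
  from adm_arrow[OF assms(1) this] adm_arrow[OF assms(2) this]
  show "max (f a) (g a) \<le> max (f b) (g b)" "max (f b) (g b) \<le> Suc (max (f a) (g a))" by auto
qed (simp add: adm_outside assms)

text \<open>The roots \<open>inv_transport f (vroot x)\<close> only depend on \<open>x\<close> and on the number of earlier letters
  \<open>x\<close>: two states at which \<open>x\<close> may be added for the same time agree at the neighbours of \<open>x\<close>,
  so they differ by letters that commute with \<open>x\<close>.\<close>

lemma inv_transport_root_cong:
  assumes f: "addable f x" and g: "addable g x" and eq: "f x = g x"
  shows "inv_transport f (vroot x) = inv_transport g (vroot x)"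
proof -
  define m where "m = (\<lambda>v. min (f v) (g v))"
  have am: "adm m" unfolding m_def using f g addable_adm adm_min by blast
  have *: "inv_transport h (vroot x) = inv_transport m (vroot x)"
    if h: "addable h x" "h = f \<or> h = g" for h
  proof -
    have "m \<le> h" using h(2) by (auto simp: m_def le_fun_def)
    then obtain xs where xs: "walk m xs" "bumps m xs = h"
      using walk_extend[OF am addable_adm[OF h(1)]] by blast
    have na: "y \<in> V \<and> y \<noteq> x \<and> (x, y) \<notin> E" if "y \<in> set xs" for y
    proof -
      have "count_list xs y \<noteq> 0" using that by (simp add: count_list_0_iff)
      then have "h y > m y" using fun_cong[OF xs(2), of y] by (simp add: bumps_apply)
      then have "f y \<noteq> g y" using h(2) by (auto simp: m_def)
      moreover have "f y = g y" if "(x, y) \<in> E"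
        using addable_edge[OF f that] addable_edge[OF g that] eq by simp
      ultimately show ?thesis using eq walk_verts[OF xs(1)] that by (auto simp: in_lists_conv_set)
    qed
    have "apply_word ys (vroot x) = vroot x" if "set ys \<subseteq> set xs" for ys
      using that by (induction ys) (use na addable_verts[OF f] reflection_nonadjacent in auto)
    then have "transport h (inv_transport m (vroot x)) = vroot x"
      using transport_walk[OF am xs(1), of "inv_transport m (vroot x)"] xs(2) transport_inv_transport[OF am] by simp
    then show ?thesis using inv_transport_eqI addable_adm[OF h(1)] by blast
  qed
  show ?thesis using *[OF f] *[OF g] by simp
qed

text \<open>Take the first letter on a walk from \<open>f\<close> to \<open>g\<close> at which the
  root turns negative. By \<open>reflection_makes_negative\<close> the transported root is the
  simple root of this letter at that moment.\<close>

lemma sign_change: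
  assumes "adm f" "adm g" "f \<le> g" "\<beta> \<in> roots D" "pos_root D (transport f \<beta>)" "neg_root D (transport g \<beta>)"
  shows "\<exists>h x. addable h x \<and> f \<le> h \<and> bump h x \<le> g \<and> inv_transport h (vroot x) = \<beta>"
proof -
  obtain xs where xs: "walk f xs" "bumps f xs = g" using walk_extend[OF assms(1-3)] by blast
  have "\<exists>h x. addable h x \<and> f \<le> h \<and> bump h x \<le> bumps f xs \<and> inv_transport h (vroot x) = \<beta>"
    if "adm f" "walk f xs" "pos_root D (transport f \<beta>)" "neg_root D (transport (bumps f xs) \<beta>)" for xs f
    using that
  proof (induction xs arbitrary: f)
    case Nil
    then show ?case using root_pos_neg[OF transport_roots[OF Nil(1) assms(4)]] by simp
  next
    case (Cons x xs)
    then have x: "addable f x" "adm (bump f x)" using adm_bump by auto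
    have le: "bump f x \<le> bumps (bump f x) xs" by (auto simp: le_fun_def bumps_ge)
    have le': "f \<le> bump f x" by (auto simp: le_fun_def bump_apply)
    show ?case
    proof (cases "neg_root D (transport (bump f x) \<beta>)")
      case True
      then have "transport f \<beta> = vroot x"
        using reflection_makes_negative[OF Cons.prems(3) rho_gens] x addable_verts by (simp add: transport_bump)
      then have "inv_transport f (vroot x) = \<beta>" using inv_transport_eqI addable_adm[OF x(1)] by blast
      then show ?thesis using x le by (intro exI[of _ f] exI[of _ x]) auto
    next
      case False
      then have "pos_root D (transport (bump f x) \<beta>)" using root_pos_neg transport_roots x assms(4) by blast
      then obtain h y where "addable h y" "bump f x \<le> h" "bump h y \<le> bumps (bump f x) xs" "inv_transport h (vroot y) = \<beta>"
        using Cons.IH[OF x(2)] Cons.prems by auto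
      then show ?thesis using le' order_trans by (intro exI[of _ h] exI[of _ y]) (auto intro: order_trans)
    qed
  qed
  from this[OF assms(1) xs(1) assms(5)] show ?thesis using assms xs by simp
qed

lemma sign_change':
  assumes "adm f" "adm g" "f \<le> g" "\<beta> \<in> roots D" "neg_root D (transport f \<beta>)" "pos_root D (transport g \<beta>)"
  shows "\<exists>h x. addable h x \<and> f \<le> h \<and> bump h x \<le> g \<and> inv_transport h (vroot x) = - \<beta>"
proof (rule sign_change[OF assms(1-3) uminus_roots[OF assms(4)]])
  have "- (- transport f \<beta>) = transport f \<beta>" by (simp add: fun_Compl_def)
  then show "pos_root D (transport f (- \<beta>))" using assms(5) neg_uminus[of "- transport f \<beta>"] by (simp add: transport_uminus)
  show "neg_root D (transport g (- \<beta>))" using assms(6) neg_uminus[of "transport g \<beta>"] by (simp add: transport_uminus)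
qed

section \<open>Functions negating a root\<close>

definition neg_set :: "('g \<Rightarrow> real) \<Rightarrow> ('v \<Rightarrow> nat) set" where
  "neg_set \<beta> = {f. adm f \<and> neg_root D (transport f \<beta>)}"

lemma apply_word_other: "r \<notin> rho D ` set xs \<Longrightarrow> apply_word xs v r = v r"
  by (simp add: apply_word_along along_other)

text \<open>The words leading from the minimum to \<open>f\<close> and to \<open>g\<close> have no letter in common, and a
  positive vector that becomes negative under a word is supported in the letters of this word.\<close>

lemma neg_set_min:
  assumes b: "\<beta> \<in> roots D" and f: "f \<in> neg_set \<beta>" and g: "g \<in> neg_set \<beta>"
  shows "(\<lambda>v. min (f v) (g v)) \<in> neg_set \<beta>"
proof (rule ccontr)
  define m where "m = (\<lambda>v. min (f v) (g v))"
  assume "\<not> ?thesis"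
  moreover have am: "adm m" unfolding m_def using f g by (auto simp: neg_set_def adm_min)
  ultimately have pos: "pos_root D (transport m \<beta>)"
    using root_pos_neg[OF transport_roots[OF am b]] by (auto simp: neg_set_def m_def)
  have *: "\<exists>xs. (\<forall>y\<in>set xs. y \<in> V \<and> m y < h y) \<and> (\<forall>r\<in>S. r \<notin> rho D ` set xs \<longrightarrow> transport m \<beta> r = 0)"
    if h: "h \<in> neg_set \<beta>" "m \<le> h" for h
  proof -
    obtain xs where xs: "walk m xs" "bumps m xs = h"
      using walk_extend[OF am _ h(2)] h(1) by (auto simp: neg_set_def)
    have "y \<in> V \<and> m y < h y" if "y \<in> set xs" for y
    proof -
      have "count_list xs y \<noteq> 0" using that by (simp add: count_list_0_iff)
      then have "h y > m y" using fun_cong[OF xs(2), of y] by (simp add: bumps_apply)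
      then show ?thesis using walk_verts[OF xs(1)] that by (auto simp: in_lists_conv_set)
    qed
    moreover have "transport m \<beta> r = 0" if "r \<in> S" "r \<notin> rho D ` set xs" for r
    proof -
      have "transport h \<beta> r = transport m \<beta> r"
        using transport_walk[OF am xs(1), of \<beta>] apply_word_other[OF that(2)] xs(2) by simp
      moreover have "transport h \<beta> r \<le> 0" using h(1) that(1) by (simp add: neg_set_def neg_root_def)
      moreover have "transport m \<beta> r \<ge> 0" using pos that(1) by (simp add: pos_root_def)
      ultimately show ?thesis by linarith
    qed
    ultimately show ?thesis by blast
  qed
  obtain xs where xs: "\<forall>y\<in>set xs. y \<in> V \<and> m y < f y" "\<forall>r\<in>S. r \<notin> rho D ` set xs \<longrightarrow> transport m \<beta> r = 0"
    using *[OF f] by (auto simp: m_def le_fun_def)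
  obtain ys where ys: "\<forall>y\<in>set ys. y \<in> V \<and> m y < g y" "\<forall>r\<in>S. r \<notin> rho D ` set ys \<longrightarrow> transport m \<beta> r = 0"
    using *[OF g] by (auto simp: m_def le_fun_def)
  obtain r where r: "r \<in> S" "transport m \<beta> r \<noteq> 0" using root_nonzero[OF transport_roots[OF am b]] by blast
  then obtain x y where "x \<in> set xs" "r = rho D x" "y \<in> set ys" "r = rho D y" using xs(2) ys(2) by blast
  then have "x \<in> V" "m x < f x" "m x < g x" using xs(1) ys(1) rho_eq_iff by auto
  then show False by (auto simp: m_def)
qed

text \<open>A member with the smallest total is the least one: its minimum with any other member
  lies in \<open>N\<close> and cannot have a smaller total.\<close>

lemma least_adm:
  assumes "N \<noteq> {}" "\<And>f. f \<in> N \<Longrightarrow> adm f" "\<And>f g. f \<in> N \<Longrightarrow> g \<in> N \<Longrightarrow> (\<lambda>v. min (f v) (g v)) \<in> N"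
  shows "\<exists>f\<in>N. \<forall>g\<in>N. f \<le> g"
proof -
  define size where "size f = (\<Sum>v\<in>V. f v)" for f :: "'v \<Rightarrow> nat"
  obtain f where f: "f \<in> N" "\<And>g. g \<in> N \<Longrightarrow> size f \<le> size g"
    using assms(1) arg_min_nat_lemma[of "\<lambda>f. f \<in> N" _ size] by (metis all_not_in_conv)
  have "f \<le> g" if g: "g \<in> N" for g
  proof (rule ccontr)
    assume "\<not> f \<le> g"
    then obtain v where v: "g v < f v" by (auto simp: le_fun_def not_le)
    then have "v \<in> V" using adm_outside[OF assms(2)[OF f(1)], of v] by (cases "v \<in> V") auto
    then have "size (\<lambda>v. min (f v) (g v)) < size f"
      unfolding size_def using v finite_verts by (intro sum_strict_mono_ex1) (auto intro!: bexI[of _ v])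
    then show False using f(2)[OF assms(3)[OF f(1) g]] by simp
  qed
  then show ?thesis using f(1) by blast
qed

section \<open>The Euler form\<close>

text \<open>The Gram matrix cut in half: the diagonal is halved and the weight of an edge is kept
  only in the direction of its arrow after \<open>f\<close>, so the symmetrization is
  \<open>gram\<close>. With all weights -1 this is the usual Euler form of a quiver.\<close>

definition euler_coeff :: "('v \<Rightarrow> nat) \<Rightarrow> 'v \<Rightarrow> 'v \<Rightarrow> real" where
  "euler_coeff f s t = (if s = t then 1 else if (s, t) \<in> reorient f then gram (rho D s) (rho D t) else 0)"

definition euler :: "('v \<Rightarrow> nat) \<Rightarrow> ('g \<Rightarrow> real) \<Rightarrow> ('g \<Rightarrow> real) \<Rightarrow> real" where
  "euler f p q = (\<Sum>s\<in>V. \<Sum>t\<in>V. p (rho D s) * q (rho D t) * euler_coeff f s t)"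

lemma euler_lin:
  "euler f (\<lambda>r. a * p r + b * q r) w = a * euler f p w + b * euler f q w"
  "euler f w (\<lambda>r. a * p r + b * q r) = a * euler f w p + b * euler f w q"
  unfolding euler_def sum_distrib_left sum.distrib[symmetric]
  by (auto intro!: sum.cong simp: algebra_simps)

lemma bform_verts: "x \<in> V \<Longrightarrow> bform D (vroot x) v = (\<Sum>t\<in>V. v (rho D t) * gram (rho D x) (rho D t))"
  by (simp add: bform_simple rho_gens sum.reindex_bij_betw[OF rho_bij, of "\<lambda>t. v t * gram (rho D x) t", symmetric])

lemma gram_nonadjacent: "x \<in> V \<Longrightarrow> y \<in> V \<Longrightarrow> x \<noteq> y \<Longrightarrow> (x, y) \<notin> E \<Longrightarrow> gram (rho D x) (rho D y) = 0"
  using gram_eq_0_iff[of "rho D x" "rho D y"] rho_gens rho_eq_iff by (auto simp: edges_def)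

lemma sum_verts_delta: "x \<in> V \<Longrightarrow> (\<Sum>t\<in>V. of_bool (t = x) * (h t :: real)) = h x"
  using finite_verts by (simp add: of_bool_def if_distrib[of "\<lambda>z. z * _"] cong: if_cong)

lemma root_apply: "x \<in> V \<Longrightarrow> t \<in> V \<Longrightarrow> vroot x (rho D t) = of_bool (t = x)"
  by (simp add: simple_root_def rho_eq_iff)

lemma addable_sink: "addable f x \<Longrightarrow> (x, t) \<notin> reorient f"
  using sink_iff[of f x] by (auto simp: addable_adm sink_def)

lemma addable_source: "addable f x \<Longrightarrow> (t, x) \<in> E \<Longrightarrow> (t, x) \<in> reorient f"
  using addable_edge[of f x t] edges_sym[of t x] arrows_total[of x t] by (auto simp: reorient_def)

text \<open>No arrow starts at a sink, so row \<open>x\<close> is a unit vector, while column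
  \<open>x\<close> carries all Gram weights at \<open>x\<close> except half of the diagonal
  one.\<close>

lemma euler_sink:
  assumes "addable f x"
  shows "euler f (vroot x) q = q (rho D x)" "euler f q (vroot x) = bform D (vroot x) q - q (rho D x)"
proof -
  have x: "x \<in> V" using assms addable_verts by blast
  have "euler f (vroot x) q = (\<Sum>s\<in>V. of_bool (s = x) * (\<Sum>t\<in>V. q (rho D t) * euler_coeff f s t))"
    unfolding euler_def sum_distrib_left using x by (auto intro!: sum.cong simp: root_apply)
  also have "\<dots> = (\<Sum>t\<in>V. q (rho D t) * euler_coeff f x t)" by (simp only: sum_verts_delta[OF x])
  also have "\<dots> = (\<Sum>t\<in>V. of_bool (t = x) * q (rho D t))"
  proof (rule sum.cong[OF HOL.refl])
    show "q (rho D t) * euler_coeff f x t = of_bool (t = x) * q (rho D t)" for t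
      using addable_sink[OF assms, of t] by (simp add: euler_coeff_def)
  qed
  finally show "euler f (vroot x) q = q (rho D x)" by (simp only: sum_verts_delta[OF x])
  have "euler f q (vroot x) = (\<Sum>s\<in>V. \<Sum>t\<in>V. of_bool (t = x) * (q (rho D s) * euler_coeff f s t))"
    unfolding euler_def using x by (auto intro!: sum.cong simp: root_apply)
  also have "\<dots> = (\<Sum>s\<in>V. q (rho D s) * euler_coeff f s x)" by (simp only: sum_verts_delta[OF x])
  also have "\<dots> = (\<Sum>s\<in>V. q (rho D s) * gram (rho D x) (rho D s) - of_bool (s = x) * q (rho D s))"
  proof (rule sum.cong[OF HOL.refl])
    fix s assume s: "s \<in> V"
    show "q (rho D s) * euler_coeff f s x = q (rho D s) * gram (rho D x) (rho D s) - of_bool (s = x) * q (rho D s)"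
      using s x addable_source[OF assms, of s] gram_nonadjacent[of s x] gram_self rho_gens
        gram_sym[of "rho D s" "rho D x"]
      by (auto simp: euler_coeff_def reorient_def)
  qed
  also have "\<dots> = bform D (vroot x) q - q (rho D x)"
    by (simp only: sum_subtractf sum_verts_delta[OF x] bform_verts[OF x])
  finally show "euler f q (vroot x) = bform D (vroot x) q - q (rho D x)" .
qed

text \<open>Reversing the arrows at \<open>x\<close> moves the entries of column \<open>x\<close>
  into row \<open>x\<close>; the diagonal terms of the two \<open>bform\<close> values
  cancel.\<close>

lemma euler_bump:
  assumes "addable f x"
  shows "euler (bump f x) p q = euler f p q + p (rho D x) * bform D (vroot x) q - q (rho D x) * bform D (vroot x) p"
proof -
  have x: "x \<in> V" using assms addable_verts by blast
  define G where "G s t = gram (rho D s) (rho D t)" for s t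
  have c: "euler_coeff (bump f x) s t = euler_coeff f s t + of_bool (s = x) * G x t - of_bool (t = x) * G x s"
    if "s \<in> V" "t \<in> V" for s t
  proof -
    have rb: "(a, b) \<in> reorient (bump f x) \<longleftrightarrow> (if a = x \<or> b = x then (b, a) \<in> reorient f else (a, b) \<in> reorient f)" for a b
      unfolding reverse_at_reorient[OF assms, symmetric] by (auto simp: reverse_at_def)
    have re: "(a, b) \<in> reorient f \<Longrightarrow> (a, b) \<in> E" for a b by (auto simp: reorient_def)
    consider "s = t" | "s \<noteq> t" "s = x" | "s \<noteq> t" "t = x" | "s \<noteq> t" "s \<noteq> x" "t \<noteq> x" by blast
    then show ?thesis
    proof cases
      case 1
      then show ?thesis by (auto simp: euler_coeff_def)
    next
      case 2
      have "G x t = 0" if "(t, x) \<notin> reorient f"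
        using that addable_source[OF assms] edges_sym gram_nonadjacent[of x t] 2 x \<open>t \<in> V\<close> by (auto simp: G_def)
      then show ?thesis using 2 addable_sink[OF assms, of t] by (auto simp: euler_coeff_def rb G_def)
    next
      case 3
      have "G x s = 0" if "(s, x) \<notin> reorient f"
        using that addable_source[OF assms] edges_sym gram_nonadjacent[of x s] 3 x \<open>s \<in> V\<close> by (auto simp: G_def)
      moreover have "G x s = G s x" using gram_sym rho_gens x \<open>s \<in> V\<close> by (simp add: G_def)
      ultimately show ?thesis using 3 addable_sink[OF assms, of s] by (auto simp: euler_coeff_def rb G_def)
    next
      case 4
      then show ?thesis by (simp add: euler_coeff_def rb)
    qed
  qed
  have "euler (bump f x) p q = (\<Sum>s\<in>V. \<Sum>t\<in>V. p (rho D s) * q (rho D t) * euler_coeff f s t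
      + of_bool (s = x) * (p (rho D s) * (q (rho D t) * G x t)) - of_bool (t = x) * (q (rho D t) * (p (rho D s) * G x s)))"
    unfolding euler_def by (auto intro!: sum.cong simp: c algebra_simps)
  also have "\<dots> = euler f p q + (\<Sum>s\<in>V. of_bool (s = x) * (p (rho D s) * (\<Sum>t\<in>V. q (rho D t) * G x t)))
     - (\<Sum>s\<in>V. \<Sum>t\<in>V. of_bool (t = x) * (q (rho D t) * (p (rho D s) * G x s)))"
    unfolding euler_def sum.distrib sum_subtractf by (simp only: sum_distrib_left)
  also have "\<dots> = euler f p q + p (rho D x) * bform D (vroot x) q - q (rho D x) * bform D (vroot x) p"
    by (simp only: sum_verts_delta[OF x] bform_verts[OF x] G_def) (simp add: sum_distrib_left mult_ac)
  finally show ?thesis .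
qed

text \<open>The analogue of the invariance of the Euler form under reflection functors at a sink; it
  is a computation from the two preceding lemmas.\<close>

lemma euler_reflection:
  assumes "addable f x"
  shows "euler (bump f x) (reflection D (rho D x) p) (reflection D (rho D x) q) = euler f p q"
proof -
  have x: "x \<in> V" using assms addable_verts by blast
  have b: "bform D (vroot x) (vroot x) = 2" using x rho_gens by (simp add: bform_simple2 gram_self)
  have r: "vroot x (rho D x) = 1" using x by (simp add: root_apply)
  show ?thesis unfolding reflection_apply euler_lin euler_bump[OF assms] euler_sink[OF assms] b r
    by (simp add: algebra_simps)
qed

lemma euler_walk: "walk f xs \<Longrightarrow> euler (bumps f xs) (apply_word xs p) (apply_word xs q) = euler f p q"
  by (induction xs arbitrary: f p q) (auto simp: euler_reflection)

text \<open>The coordinate at a sink is a value of the Euler form, and invariance carries this value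
  back to \<open>null\<close>. It thus depends on \<open>f\<close> only through the root attached to
  the letter \<open>x\<close>.\<close>

lemma transport_coordinate:
  assumes "addable f x"
  shows "transport f q (rho D x) = euler null (inv_transport f (vroot x)) q"
proof -
  have a: "adm f" using assms by (rule addable_adm)
  have "euler f (transport f p) (transport f q) = euler null p q" for p
    using euler_walk[OF word_of(1)[OF a], of p q] word_of(2)[OF a] by (simp add: transport_def)
  from this[of "inv_transport f (vroot x)"] show ?thesis using a assms by (simp add: transport_inv_transport euler_sink)
qed

lemma euler_uminus: "euler f (- p) q = - euler f p q"
  using euler_lin(1)[of f "-1" p 0 p q] by (simp add: fun_Compl_def)


section \<open>Roots occurring twice\<close>

text \<open>Opposite roots define the same reflection, and \<open>bump h u \<le> g\<close> places
  the letter \<open>u\<close> before \<open>y\<close>. So the reflection attached to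
  \<open>y\<close> has already been used, which is how a word fails to be reduced.\<close>

definition repeated :: "('v \<Rightarrow> nat) \<Rightarrow> 'v \<Rightarrow> bool" where
  "repeated g y \<longleftrightarrow> addable g y \<and>
     (\<exists>h u. addable h u \<and> bump h u \<le> g \<and> inv_transport h (vroot u) = - inv_transport g (vroot y))"

lemma repeated_coordinate:
  assumes "addable g y" "addable h u" "inv_transport h (vroot u) = - inv_transport g (vroot y)"
  shows "transport h q (rho D u) = - transport g q (rho D y)"
  by (simp add: transport_coordinate[OF assms(1)] transport_coordinate[OF assms(2)] assms(3) euler_uminus)

lemma bump_ge: "f \<le> bump f x" by (auto simp: le_fun_def bump_apply)

text \<open>Follow the root q attached to \<open>z\<close>. Just before \<open>y\<close> it is the
  reflection of \<alpha>_z at \<open>y\<close>, with coordinate \<open>- gram\<close> at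
  \<open>y\<close>, which is positive. By the Euler form its coordinate just before \<open>u\<close>
  is negative, so q is negative there, although it is the positive root \<alpha>_z just before
  \<open>z\<close>. The sign change in between happens at a letter with root -q.\<close>

lemma repeated_step:
  assumes r: "repeated g y" and z: "addable (bump g y) z" and e: "(y, z) \<in> E"
  shows "repeated (bump g y) z"
proof -
  obtain h u where hu: "addable h u" "bump h u \<le> g" "inv_transport h (vroot u) = - inv_transport g (vroot y)"
    and y: "addable g y" using r unfolding repeated_def by blast
  define q where "q = inv_transport (bump g y) (vroot z)"
  have V: "y \<in> V" "z \<in> V" "u \<in> V" "y \<noteq> z" using e edges_verts addable_verts hu(1) by blast+
  have ad: "adm (bump g y)" "adm g" "adm h" using z y hu addable_adm by blast+
  have qr: "q \<in> roots D" unfolding q_def using ad V root_in_roots inv_transport_roots by blast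
  have tq: "transport (bump g y) q = vroot z" unfolding q_def using ad transport_inv_transport by blast
  then have "transport g q = reflection D (rho D y) (vroot z)"
    using transport_bump[OF y, of q] reflection_reflection[OF rho_gens[OF V(1)], of "transport g q"] by metis
  then have "transport g q (rho D y) = - gram (rho D y) (rho D z)"
    using rho_gens[OF V(1)] rho_gens[OF V(2)] root_apply[OF V(2,1)] V(4)
    by (simp add: reflection_self bform_simple2)
  moreover have "gram (rho D y) (rho D z) < 0"
    using gram_neg_iff[OF rho_gens[OF V(1)] rho_gens[OF V(2)]] rho_eq_iff[OF V(1,2)] V(4) e
    by (simp add: edges_def)
  ultimately have "transport h q (rho D u) < 0" using repeated_coordinate[OF y hu(1,3), of q] by simp
  then have "\<not> pos_root D (transport h q)" using rho_gens[OF V(3)] unfolding pos_root_def by (meson not_le)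
  then have neg: "neg_root D (transport h q)" using root_pos_neg[OF transport_roots[OF ad(3) qr]] by simp
  have pos: "pos_root D (transport (bump g y) q)" using tq pos_simple rho_gens V by simp
  have "h \<le> bump g y" using order_trans[OF bump_ge order_trans[OF hu(2) bump_ge]] .
  then obtain h' x where h': "addable h' x" "bump h' x \<le> bump g y" "inv_transport h' (vroot x) = - q"
    using sign_change'[OF ad(3,1) _ qr neg pos] by blast
  then show ?thesis using z unfolding repeated_def q_def by blast
qed

text \<open>A repetition below the least negating word would climb along the edges of the graph up
  to the last letter of the word, that is, the word would negate the root twice.\<close>

lemma not_repeated_below_least:
  assumes conn: "coxeter_irreducible D"
    and b: "pos_root D \<beta>" and f: "f \<in> neg_set \<beta>" "\<And>g. g \<in> neg_set \<beta> \<Longrightarrow> f \<le> g"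
  shows "repeated g y \<Longrightarrow> bump g y \<le> f \<Longrightarrow> False"
proof (induction "\<Sum>v\<in>V. f v - g v" arbitrary: g y rule: less_induct)
  case less
  have br: "\<beta> \<in> roots D" using b by (simp add: pos_root_def)
  have af: "adm f" using f by (simp add: neg_set_def)
  have y: "addable g y" and ag: "adm g" and yV: "y \<in> V"
    using less(2) addable_adm addable_verts by (auto simp: repeated_def)
  obtain h u where hu: "addable h u" "bump h u \<le> g" "inv_transport h (vroot u) = - inv_transport g (vroot y)"
    using less(2) unfolding repeated_def by blast
  have ah: "adm h" and uV: "u \<in> V" using hu addable_adm addable_verts by blast+
  have gy: "g y < f y" using le_funD[OF less(3), of y] by (simp add: bump_apply)
  have hu': "h u < f u"
    using le_funD[OF hu(2), of u] le_funD[OF less(3), of u] by (simp add: bump_apply)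
  \<comment> \<open>Since \<open>f\<close> is least, a function smaller than \<open>f\<close> at
    some vertex does not negate \<beta>.\<close>
  have pos: "pos_root D (transport k \<beta>)" if "adm k" "k x < f x" for k x
  proof -
    have "k \<notin> neg_set \<beta>" using le_funD[OF f(2)[of k], of x] that(2) by auto
    then show ?thesis using root_pos_neg[OF transport_roots[OF that(1) br]] that(1) by (simp add: neg_set_def)
  qed
  note posg = pos[OF ag gy] and posh = pos[OF ah hu']
  have smaller: "(\<Sum>v\<in>V. f v - bump g x v) < (\<Sum>v\<in>V. f v - g v)" if "x \<in> V" "g x < f x" for x
    using that finite_verts by (intro sum_strict_mono_ex1) (auto simp: bump_apply intro!: bexI[of _ x])
  obtain xs where xs: "walk (bump g y) xs" "bumps (bump g y) xs = f"
    using walk_extend[OF adm_bump[OF y] af less(3)] by blast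
  show False
  proof (cases xs)
    \<comment> \<open>Here \<open>y\<close> is the last letter and its root is \<beta>, so just
      before the earlier letter \<open>u\<close> the root \<beta> is already sent to the negative of
      a simple root.\<close>
    case Nil
    then have "neg_root D (reflection D (rho D y) (transport g \<beta>))"
      using f(1) xs by (simp add: neg_set_def flip: transport_bump[OF y])
    then have "transport g \<beta> = vroot y" using reflection_makes_negative[OF posg] rho_gens yV by blast
    then have "inv_transport g (vroot y) = \<beta>" using inv_transport_eqI ag by blast
    then have "inv_transport h (vroot u) = - \<beta>" using hu(3) by simp
    then have "vroot u = - transport h \<beta>" using transport_inv_transport[OF ah, of "vroot u"] by (simp add: transport_uminus)
    then have "transport h \<beta> = - vroot u" by (simp add: fun_Compl_def)
    then have "neg_root D (transport h \<beta>)" using neg_uminus pos_simple[OF rho_gens[OF uV]] by simp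
    then show False using posh root_pos_neg[OF transport_roots[OF ah br]] by simp
  next
    case (Cons z zs)
    then have z: "addable (bump g y) z" "z \<in> V" using xs addable_verts by auto
    have le: "bump (bump g y) z \<le> f" using xs(2) Cons bumps_ge[of "bump (bump g y) z" _ zs] by (auto simp: le_fun_def)
    \<comment> \<open>If the next letter \<open>z\<close> is adjacent to \<open>y\<close>, the
      repetition passes on to \<open>z\<close>. If it commutes with \<open>y\<close>, it can be
      applied first and leaves the root of \<open>y\<close> unchanged. Both cases come closer to
      \<open>f\<close>.\<close>
    consider "(y, z) \<in> E" | "z \<noteq> y" "(y, z) \<notin> E" | "z = y" by blast
    then show False
    proof cases
      case 1
      then show False using less(1)[OF smaller[OF yV gy] repeated_step[OF less(2) z(1)] le] by blast
    next
      case 2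
      then have gz: "addable g z" using addable_bump_nonadjacent[OF y] z by blast
      have gy': "addable (bump g z) y"
        using addable_bump_nonadjacent[OF gz, of y] 2 edges_sym y by blast
      have "inv_transport (bump g z) (vroot y) = inv_transport g (vroot y)"
        using inv_transport_root_cong[OF gy' y] 2 by (simp add: bump_apply)
      then have rep: "repeated (bump g z) y"
        unfolding repeated_def using gy' hu(1,3) order_trans[OF hu(2) bump_ge]
        by (intro conjI exI[of _ h] exI[of _ u]) simp_all
      have "bump (bump g z) y = bump (bump g y) z" using 2 by (auto simp: bump_def fun_eq_iff)
      moreover have "g z < f z" using le_funD[OF le, of z] 2 by (simp add: bump_apply)
      ultimately show False using less(1)[OF smaller[OF z(2)] rep] le by simp
    next
      case 3
      \<comment> \<open>The same letter twice in a row means that \<open>y\<close> has no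
        neighbours, so connectedness leaves only this vertex. The coordinates of \<beta> at the two
        moments are nonnegative and opposite, hence 0, and a root with a single coordinate cannot
        vanish.\<close>
      have iso: "(y, w) \<notin> E" for w
      proof
        assume e: "(y, w) \<in> E"
        then have "w \<noteq> y" using edges_verts by blast
        then show False using addable_edge[OF y e] addable_edge[of "bump g y" y w] z 3 e by (simp add: bump_apply)
      qed
      have single: "x = y" if "x \<in> V" for x
      proof -
        have "(y, x) \<in> E\<^sup>*" using conn yV that by (auto simp: coxeter_irreducible_def)
        then show ?thesis by (cases rule: converse_rtranclE) (use iso in auto)
      qed
      have "transport h \<beta> (rho D u) \<ge> 0" "transport g \<beta> (rho D y) \<ge> 0"
        using posh posg rho_gens uV yV by (auto simp: pos_root_def)
      then have "transport g \<beta> (rho D y) = 0" using repeated_coordinate[OF y hu(1,3), of \<beta>] by simp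
      moreover have "V = {y}" using single yV by blast
      then have "S = {rho D y}" using rho_bij by (simp add: bij_betw_def)
      ultimately show False using root_nonzero[OF transport_roots[OF ag br]] by simp
    qed
  qed
qed

section \<open>Reduced functions and common negators\<close>

text \<open>Positivity of all attached roots is the usual criterion for a word to be a reduced
  expression in the group.\<close>

definition reduced :: "('v \<Rightarrow> nat) \<Rightarrow> bool" where
  "reduced f \<longleftrightarrow> (\<forall>g y. addable g y \<and> bump g y \<le> f \<longrightarrow> pos_root D (inv_transport g (vroot y)))"

text \<open>A negative root q attached to a letter starts negative at \<open>null\<close> and is a
  positive simple root just before its letter. It changes sign at an earlier letter with root -q,
  and this is a repetition.\<close>

lemma reduced_least:
  assumes conn: "coxeter_irreducible D"
    and b: "pos_root D \<beta>" and f: "f \<in> neg_set \<beta>" "\<And>g. g \<in> neg_set \<beta> \<Longrightarrow> f \<le> g"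
  shows "reduced f"
  unfolding reduced_def
proof (intro allI impI, rule ccontr)
  fix g y assume gy: "addable g y \<and> bump g y \<le> f" and np: "\<not> pos_root D (inv_transport g (vroot y))"
  define q where "q = inv_transport g (vroot y)"
  have ag: "adm g" and yV: "y \<in> V" using gy addable_adm addable_verts by blast+
  have qr: "q \<in> roots D" unfolding q_def using ag yV root_in_roots inv_transport_roots by blast
  have 1: "neg_root D (transport null q)" using np root_pos_neg[OF qr] by (simp add: transport_zero q_def)
  have 2: "pos_root D (transport g q)"
    unfolding q_def using transport_inv_transport ag pos_simple rho_gens yV by simp
  have "null \<le> g" by (simp add: le_fun_def)
  then obtain h x where "addable h x" "bump h x \<le> g" "inv_transport h (vroot x) = - q"
    using sign_change'[OF adm_zero ag _ qr 1 2] by blast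
  then have "repeated g y" using gy unfolding repeated_def q_def by blast
  then show False using not_repeated_below_least[OF conn b f] gy by blast
qed

text \<open>If \<open>g y\<close> is below \<open>h y\<close>, where \<open>h\<close> is one of the
  two functions, then \<open>g\<close> does not exceed \<open>h\<close> at the neighbours of
  \<open>y\<close> either. So \<open>y\<close> can be added to the minimum of \<open>g\<close> and
  \<open>h\<close> as the same occurrence, with the same root, and this letter belongs to
  \<open>h\<close>.\<close>

lemma reduced_max:
  assumes "adm f" "adm f'" "reduced f" "reduced f'"
  shows "reduced (\<lambda>v. max (f v) (f' v))"
  unfolding reduced_def
proof (intro allI impI)
  fix g y assume gy: "addable g y \<and> bump g y \<le> (\<lambda>v. max (f v) (f' v))"
  have *: "pos_root D (inv_transport g (vroot y))" if h: "adm h" "reduced h" "g y < h y" for h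
  proof -
    define m where "m = (\<lambda>v. min (g v) (h v))"
    have my: "m y = g y" using h(3) by (simp add: m_def)
    have am: "addable m y" unfolding addable_def
    proof (intro conjI allI impI)
      show "adm m" unfolding m_def using h gy addable_adm adm_min by blast
      show "y \<in> V" using gy addable_verts by blast
      fix w assume e: "(y, w) \<in> E"
      then have gw: "g w = g y + of_bool ((y, w) \<in> A)" using gy addable_edge by blast
      have "g w \<le> h w"
      proof (cases "(y, w) \<in> A")
        case True
        then show ?thesis using gw adm_arrow[OF h(1) True] h(3) by simp
      next
        case False
        then have "(w, y) \<in> A" using arrows_total[OF e] by blast
        from adm_arrow[OF h(1) this] show ?thesis using gw False h(3) by simp
      qed
      then show "m w = m y + of_bool ((y, w) \<in> A)" using gw my by (simp add: m_def)
    qed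
    have "bump m y \<le> h" using h(3) by (auto simp: le_fun_def bump_apply m_def)
    then have "pos_root D (inv_transport m (vroot y))" using h(2) am by (simp add: reduced_def)
    then show ?thesis using inv_transport_root_cong[OF am conjunct1[OF gy] my] by simp
  qed
  have "g y < f y \<or> g y < f' y"
    using le_funD[OF conjunct2[OF gy], of y] by (auto simp: bump_apply less_max_iff_disj Suc_le_eq)
  then show "pos_root D (inv_transport g (vroot y))" using * assms by blast
qed

text \<open>To become positive again, \<beta> would have to pass a letter with attached root
  -\<beta>, which is negative.\<close>

lemma neg_set_reduced:
  assumes "reduced F" "adm F" "f \<le> F" "f \<in> neg_set \<beta>" "pos_root D \<beta>"
  shows "F \<in> neg_set \<beta>"
proof (rule ccontr)
  assume "F \<notin> neg_set \<beta>"
  have br: "\<beta> \<in> roots D" using assms by (simp add: pos_root_def)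
  have "pos_root D (transport F \<beta>)"
    using \<open>F \<notin> _\<close> assms root_pos_neg[OF transport_roots[OF _ br]] by (auto simp: neg_set_def)
  then obtain h x where hx: "addable h x" "bump h x \<le> F" "inv_transport h (vroot x) = - \<beta>"
    using sign_change'[of f F \<beta>] assms br by (auto simp: neg_set_def)
  then have "pos_root D (inv_transport h (vroot x))" using assms(1) unfolding reduced_def by blast
  then have "pos_root D (- \<beta>)" using hx(3) by simp
  then show False using assms(5) neg_uminus[of \<beta>] root_pos_neg[OF uminus_roots[OF br]] by blast
qed

lemma least_negator:
  assumes b: "pos_root D \<beta>" and ne: "neg_set \<beta> \<noteq> {}"
  shows "\<exists>f\<in>neg_set \<beta>. \<forall>g\<in>neg_set \<beta>. f \<le> g"
proof (rule least_adm[OF ne])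
  show "adm f" if "f \<in> neg_set \<beta>" for f using that by (simp add: neg_set_def)
  show "(\<lambda>v. min (f v) (g v)) \<in> neg_set \<beta>" if "f \<in> neg_set \<beta>" "g \<in> neg_set \<beta>" for f g
    using neg_set_min that b by (simp add: pos_root_def)
qed

text \<open>The maximum of the least negators of the single roots is reduced and lies above each of
  them, so all the roots stay negative.\<close>

lemma common_negator:
  assumes conn: "coxeter_irreducible D" and "finite \<Psi>"
    and "\<And>\<beta>. \<beta> \<in> \<Psi> \<Longrightarrow> pos_root D \<beta> \<and> neg_set \<beta> \<noteq> {}"
  shows "\<exists>F. adm F \<and> reduced F \<and> (\<forall>\<beta>\<in>\<Psi>. F \<in> neg_set \<beta>)"
  using assms(2,3)
proof (induction \<Psi> rule: finite_induct)
  case empty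
  have "reduced null" unfolding reduced_def
  proof (intro allI impI)
    fix g y assume "addable g y \<and> bump g y \<le> null"
    then have "bump g y y \<le> 0" by (auto simp: le_fun_def)
    then show "pos_root D (inv_transport g (vroot y))" by (simp add: bump_apply)
  qed
  then show ?case using adm_zero by blast
next
  case (insert \<beta> \<Psi>)
  then obtain F where F: "adm F" "reduced F" "\<forall>\<beta>\<in>\<Psi>. F \<in> neg_set \<beta>" by auto
  have b: "pos_root D \<beta>" "neg_set \<beta> \<noteq> {}" using insert by auto
  obtain f where f: "f \<in> neg_set \<beta>" "\<And>g. g \<in> neg_set \<beta> \<Longrightarrow> f \<le> g"
    using least_negator[OF b] by blast
  define G where "G = (\<lambda>v. max (f v) (F v))"
  have af: "adm f" using f by (simp add: neg_set_def)
  have "reduced G" unfolding G_def using reduced_max[OF af F(1) reduced_least[OF conn b(1) f] F(2)] .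
  moreover have "adm G" unfolding G_def by (rule adm_max[OF af F(1)])
  moreover have "f \<le> G" "F \<le> G" by (auto simp: G_def le_fun_def)
  moreover have "G \<in> neg_set \<gamma>" if "\<gamma> \<in> \<Psi>" for \<gamma>
    using neg_set_reduced[OF \<open>reduced G\<close> \<open>adm G\<close> \<open>F \<le> G\<close>] that F(3) insert.prems by blast
  moreover have "G \<in> neg_set \<beta>"
    by (rule neg_set_reduced[OF \<open>reduced G\<close> \<open>adm G\<close> \<open>f \<le> G\<close> f(1) b(1)])
  ultimately show ?case by blast
qed

section \<open>The graph monoid\<close>

definition word_class :: "'v list \<Rightarrow> 'v list set" where
  "word_class us = graph_cong D `` {us}"

definition element :: "('v \<Rightarrow> nat) \<Rightarrow> 'v list set" where
  "element f = word_class (rev (word_of f))"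

lemma word_class_eq_iff:
  "us \<in> lists V \<Longrightarrow> vs \<in> lists V \<Longrightarrow> word_class us = word_class vs \<longleftrightarrow> (us, vs) \<in> graph_cong D"
  unfolding word_class_def by (rule eq_equiv_class_iff[OF graph_cong_equiv])

lemma in_word_class: "us \<in> lists V \<Longrightarrow> us \<in> word_class us"
  unfolding word_class_def by (rule equiv_class_self[OF graph_cong_equiv])

lemma carrier_graph_monoid: "carrier (graph_monoid D) = word_class ` lists V"
  by (auto simp: graph_monoid_def quotient_def word_class_def)

lemma word_class_mult:
  assumes "us \<in> lists V" "vs \<in> lists V"
  shows "word_class us \<otimes>\<^bsub>graph_monoid D\<^esub> word_class vs = word_class (us @ vs)"
proof -
  have "congruent2 (graph_cong D) (graph_cong D) (\<lambda>xs ys. graph_cong D `` {xs @ ys})"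
    unfolding congruent2_def
    using equiv_class_eq[OF graph_cong_equiv] graph_cong_append by blast
  then show ?thesis
    unfolding graph_monoid_def word_class_def
    using UN_equiv_class2[OF graph_cong_equiv graph_cong_equiv _ assms] by simp
qed

lemma one_graph_monoid: "\<one>\<^bsub>graph_monoid D\<^esub> = word_class []"
  by (simp add: graph_monoid_def word_class_def)

lemma image_word_class:
  assumes "us \<in> lists V" "\<And>vs. (us, vs) \<in> graph_cong D \<Longrightarrow> h vs = h us"
  shows "h ` word_class us = {h us}"
proof (intro equalityI subsetI)
  fix y assume "y \<in> h ` word_class us"
  then obtain vs where "(us, vs) \<in> graph_cong D" "y = h vs" by (auto simp: word_class_def)
  then show "y \<in> {h us}" using assms(2)[of vs] by simp
next
  fix y assume "y \<in> {h us}"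
  then show "y \<in> h ` word_class us" using in_word_class[OF assms(1)] by blast
qed

lemma rho_hom_word_class: "us \<in> lists V \<Longrightarrow> rho_hom D (word_class us) = word_prod D (map (rho D) us)"
  unfolding rho_hom_def by (subst image_word_class, assumption) (erule graph_cong_invariants(3)[symmetric], simp)

lemma rho_hom_transpose:
  assumes "us \<in> lists V"
  shows "rho_hom D (word_transpose (word_class us)) = word_prod D (map (rho D) (rev us))"
proof -
  have "(\<lambda>xs. word_prod D (map (rho D) xs)) ` rev ` word_class us = {word_prod D (map (rho D) (rev us))}"
    unfolding image_image
    by (rule image_word_class[OF assms]) (erule graph_cong_invariants(3)[OF graph_cong_invariants(4), symmetric])
  then show ?thesis by (simp add: rho_hom_def word_transpose_def)
qed

lemma word_of_rev: "adm f \<Longrightarrow> rev (word_of f) \<in> lists V"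
  by (rule rev_lists[OF word_of(3)])

lemma element_carrier: "adm f \<Longrightarrow> element f \<in> carrier (graph_monoid D)"
  unfolding carrier_graph_monoid element_def using word_of_rev by blast

lemma element_walk:
  assumes "walk null xs" "bumps null xs = f" shows "element f = word_class (rev xs)"
proof -
  have a: "adm f" using walk_adm[OF adm_zero assms(1)] assms(2) by simp
  have "(rev (word_of f), rev xs) \<in> graph_cong D"
    using walk_path_cong[OF adm_zero word_of(1)[OF a] assms(1)] word_of(2)[OF a] assms(2) by simp
  then show ?thesis unfolding element_def
    using word_class_eq_iff[OF word_of_rev[OF a] rev_lists[OF walk_verts[OF assms(1)]]] by blast
qed

lemma act_element: "adm f \<Longrightarrow> act D (rho_hom D (element f)) v = transport f v"
  and act_transpose: "adm f \<Longrightarrow> act D (rho_hom D (word_transpose (element f))) v = inv_transport f v"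
proof -
  assume f: "adm f"
  note w = word_of_rev[OF f] word_of(3)[OF f]
  show "act D (rho_hom D (element f)) v = transport f v"
    unfolding element_def rho_hom_word_class[OF w(1)] act_word_prod[OF rho_lists[OF w(1)]]
    by (simp add: transport_def apply_word_along)
  show "act D (rho_hom D (word_transpose (element f))) v = inv_transport f v"
    unfolding element_def rho_hom_transpose[OF w(1)] rev_rev_ident act_word_prod[OF rho_lists[OF w(2)]]
    by (simp add: inv_transport_def apply_word_along)
qed

lemma admissible_elements_eq: "admissible_elements D c = element ` {f. adm f}"
proof -
  have s: "sink_sequence D A xs \<longleftrightarrow> walk null xs" for xs
    using sink_sequence_iff[OF adm_zero] by (simp add: reorient_zero)
  show ?thesis
  proof (intro equalityI subsetI)
    fix X assume "X \<in> admissible_elements D c"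
    then obtain xs where xs: "X = word_class xs" "walk null (rev xs)"
      by (auto simp: admissible_elements_def s word_class_def)
    then have "X = element (bumps null (rev xs))" using element_walk[OF xs(2) HOL.refl] by simp
    then show "X \<in> element ` {f. adm f}" using walk_adm[OF adm_zero xs(2)] by blast
  next
    fix X assume "X \<in> element ` {f. adm f}"
    then obtain f where "adm f" "X = word_class (rev (word_of f))" by (auto simp: element_def)
    then show "X \<in> admissible_elements D c"
      using word_of_rev word_of(1) by (auto simp: admissible_elements_def s word_class_def intro!: exI[of _ "rev (word_of f)"])
  qed
qed

lemma element_mset:
  assumes "adm f" "us \<in> element f" shows "f v = count_list us v"
proof -
  have "(rev (word_of f), us) \<in> graph_cong D" using assms by (simp add: element_def word_class_def)
  then have "mset (word_of f) = mset us" using graph_cong_invariants(1) by fastforce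
  moreover have "f v = count_list (word_of f) v" using fun_cong[OF word_of(2)[OF assms(1)], of v] by (simp add: bumps_apply)
  ultimately show ?thesis by (simp flip: count_mset)
qed

lemma element_nonempty: "adm f \<Longrightarrow> \<exists>us. us \<in> element f"
  using in_word_class[OF word_of_rev] unfolding element_def by blast

lemma element_inj:
  assumes "adm f" "adm g" "element f = element g" shows "f = g"
proof -
  obtain us where "us \<in> element f" using element_nonempty assms(1) by blast
  then show ?thesis using element_mset assms by (metis ext)
qed

lemma prec_elementI:
  assumes "adm f" "adm g" "f \<le> g" shows "prec D (element f) (element g)"
proof -
  obtain xs where xs: "walk f xs" "bumps f xs = g" using walk_extend[OF assms] by blast
  have "element g = word_class (rev (word_of f @ xs))"
    using element_walk[of "word_of f @ xs" g] word_of[OF assms(1)] xs by simp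
  also have "\<dots> = word_class (rev xs) \<otimes>\<^bsub>graph_monoid D\<^esub> element f"
    unfolding element_def rev_append
    using word_class_mult[OF rev_lists[OF walk_verts[OF xs(1)]] word_of_rev[OF assms(1)]] by simp
  finally show ?thesis unfolding prec_def carrier_graph_monoid using rev_lists[OF walk_verts[OF xs(1)]] by blast
qed

text \<open>A right factor is what is applied first, so a right factor of an admissible word is
  again admissible. This is why a least element among the admissible negators is minimal among all
  negators.\<close>

lemma prec_elementE:
  assumes "Y \<in> carrier (graph_monoid D)" "adm g" "prec D Y (element g)"
  shows "\<exists>f. adm f \<and> f \<le> g \<and> Y = element f"
proof -
  obtain us vs where uv: "us \<in> lists V" "vs \<in> lists V" "Y = word_class vs"
    "element g = word_class us \<otimes>\<^bsub>graph_monoid D\<^esub> Y"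
    using assms unfolding prec_def carrier_graph_monoid by blast
  then have e: "word_class (rev (word_of g)) = word_class (us @ vs)"
    by (simp add: word_class_mult element_def)
  have "us @ vs \<in> lists V" using uv by auto
  then have r: "(rev (word_of g), us @ vs) \<in> graph_cong D"
    using e word_class_eq_iff[OF word_of_rev[OF assms(2)]] by blast
  have w: "walk null (rev vs @ rev us)"
    using graph_cong_invariants(2)[OF r adm_zero] word_of(1)[OF assms(2)] by simp
  then have "Y = element (bumps null (rev vs))" "adm (bumps null (rev vs))"
    using element_walk[of "rev vs"] walk_adm[OF adm_zero, of "rev vs"] uv by auto
  moreover have "bumps null (rev vs) \<le> g"
  proof (rule le_funI)
    fix v
    have "us @ vs \<in> element g" using r by (simp add: element_def word_class_def)
    then have "g v = count_list (us @ vs) v" by (rule element_mset[OF assms(2)])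
    then show "bumps null (rev vs) v \<le> g v" by (simp add: bumps_apply)
  qed
  ultimately show ?thesis by blast
qed

lemma prec_element_iff:
  assumes "adm f" "adm g" shows "prec D (element f) (element g) \<longleftrightarrow> f \<le> g"
  using prec_elementI[OF assms] prec_elementE[OF element_carrier[OF assms(1)] assms(2)] element_inj[OF assms(1)]
  by blast

lemma negates_element: "adm f \<Longrightarrow> negates D (element f) \<beta> \<longleftrightarrow> f \<in> neg_set \<beta>"
  by (simp add: negates_def act_element neg_set_def)

lemma negators_admissible: "negators D \<beta> \<inter> admissible_elements D c = element ` neg_set \<beta>"
  unfolding admissible_elements_eq negators_def using negates_element element_carrier
  by (auto simp: neg_set_def)

lemma set_negators_admissible:
  "set_negators D \<Psi> \<inter> admissible_elements D c = element ` {f. adm f \<and> (\<forall>\<beta>\<in>\<Psi>. f \<in> neg_set \<beta>)}"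
  unfolding admissible_elements_eq set_negators_def using negates_element element_carrier by auto

lemma preprojective_iff: "\<beta> \<in> preprojective_roots D c \<longleftrightarrow> pos_root D \<beta> \<and> neg_set \<beta> \<noteq> {}"
  unfolding preprojective_roots_def admissible_elements_eq using negates_element by (auto simp: neg_set_def)

lemma least_element:
  assumes N: "\<And>g. g \<in> N \<Longrightarrow> adm g" and f: "f \<in> N" "\<And>g. g \<in> N \<Longrightarrow> f \<le> g"
  shows "least (prec_order D) W (element ` N) \<longleftrightarrow> W = element f"
proof
  assume "W = element f"
  then show "least (prec_order D) W (element ` N)"
    unfolding least_def prec_order_def using assms element_carrier prec_element_iff by auto
next
  assume l: "least (prec_order D) W (element ` N)"
  then obtain g where g: "g \<in> N" "W = element g" by (auto simp: least_def)
  have "prec D (element g) (element f)" using l g f(1) by (auto simp: least_def prec_order_def)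
  then have "g \<le> f" using prec_element_iff N g f by blast
  then show "W = element f" using g f(2)[of g] by simp
qed

lemma minimal_element:
  assumes f: "adm f" "element f \<in> NN" "NN \<subseteq> carrier (graph_monoid D)"
    and m: "\<And>g. adm g \<Longrightarrow> element g \<in> NN \<Longrightarrow> f \<le> g"
  shows "prec_minimal D (element f) NN"
  unfolding prec_minimal_def
proof (intro conjI f(2) ballI impI)
  fix Y assume Y: "Y \<in> NN" "prec D Y (element f)"
  then obtain g where g: "adm g" "g \<le> f" "Y = element g" using prec_elementE[of Y f] f by blast
  then show "Y = element f" using m[of g] Y by auto
qed

section \<open>Principal words\<close>

lemma is_filter_iff: "is_filter D c F \<longleftrightarrow> F \<subseteq> V \<and> (\<forall>a b. (a, b) \<in> A \<longrightarrow> a \<in> F \<longrightarrow> b \<in> F)"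
proof
  assume "is_filter D c F"
  then show "F \<subseteq> V \<and> (\<forall>a b. (a, b) \<in> A \<longrightarrow> a \<in> F \<longrightarrow> b \<in> F)"
    using arrows_edges edges_verts by (fastforce simp: is_filter_def)
next
  assume F: "F \<subseteq> V \<and> (\<forall>a b. (a, b) \<in> A \<longrightarrow> a \<in> F \<longrightarrow> b \<in> F)"
  have "y \<in> F" if "(x, y) \<in> A\<^sup>*" "x \<in> F" for x y
    using that by (induction rule: rtrancl_induct) (use F in blast)+
  then show "is_filter D c F" using F by (auto simp: is_filter_def)
qed

abbreviation "fhull \<equiv> filter_hull D c"

lemma hull_filter: "F \<subseteq> V \<Longrightarrow> is_filter D c (fhull F)" and hull_subset: "F \<subseteq> fhull F"
  and hull_edge: "(v, w) \<in> E \<Longrightarrow> w \<in> F \<Longrightarrow> v \<in> fhull F"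
  and hull_least: "is_filter D c G \<Longrightarrow> F \<subseteq> G \<Longrightarrow> (\<And>v w. (v, w) \<in> E \<Longrightarrow> w \<in> F \<Longrightarrow> v \<in> G) \<Longrightarrow> fhull F \<subseteq> G"
proof -
  have V: "is_filter D c V" using arrows_edges edges_verts by (auto simp: is_filter_iff)
  show "is_filter D c (fhull F)" if "F \<subseteq> V"
    unfolding filter_hull_def is_filter_iff using that V edges_verts by (auto simp: is_filter_iff)
  show "F \<subseteq> fhull F" unfolding filter_hull_def by blast
  show "(v, w) \<in> E \<Longrightarrow> w \<in> F \<Longrightarrow> v \<in> fhull F" using edges_verts[of v w] unfolding filter_hull_def by blast
  show "is_filter D c G \<Longrightarrow> F \<subseteq> G \<Longrightarrow> (\<And>v w. (v, w) \<in> E \<Longrightarrow> w \<in> F \<Longrightarrow> v \<in> G) \<Longrightarrow> fhull F \<subseteq> G"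
    unfolding filter_hull_def by (rule Inter_lower) blast
qed

text \<open>Indexed from the innermost support: the factor \<open>X_j\<close> of
  \<open>W_{r,x}\<close> has support \<open>hull_iter x (r - j)\<close>, which makes the sets
  independent of \<open>r\<close>.\<close>

definition hull_iter :: "'v \<Rightarrow> nat \<Rightarrow> 'v set" where
  "hull_iter x i = (fhull ^^ i) (principal_filter D c x)"

lemma hull_iter_0: "hull_iter x 0 = principal_filter D c x"
  and hull_iter_Suc: "hull_iter x (Suc i) = fhull (hull_iter x i)"
  by (simp_all add: hull_iter_def)

lemma hull_iter_filter: "is_filter D c (hull_iter x i)"
proof (induction i)
  case 0
  show ?case unfolding hull_iter_0 is_filter_iff principal_filter_def
    using arrows_edges edges_verts by (auto intro: rtrancl_into_rtrancl)
next
  case (Suc i)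
  then show ?case unfolding hull_iter_Suc by (intro hull_filter) (simp add: is_filter_def)
qed

lemma hull_iter_verts: "hull_iter x i \<subseteq> V"
  using hull_iter_filter by (simp add: is_filter_def)

lemma hull_iter_mono: "i \<le> j \<Longrightarrow> hull_iter x i \<subseteq> hull_iter x j"
  by (induction rule: dec_induct) (use hull_subset hull_iter_Suc in blast)+

definition indicator_fun :: "'v set \<Rightarrow> 'v \<Rightarrow> nat" where
  "indicator_fun F v = of_bool (v \<in> F)"

lemma adm_indicator: "is_filter D c F \<Longrightarrow> adm (indicator_fun F)"
  by (auto simp: adm_def is_filter_iff indicator_fun_def)

lemma Supp_element: "adm f \<Longrightarrow> Supp (element f) = {v. f v > 0}"
  using element_nonempty[of f] element_mset[of f]
  by (auto simp: Supp_def) (metis count_list_0_iff gr0I less_numeral_extra(3))+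

lemma multiplicity_free_element: "adm f \<Longrightarrow> multiplicity_free (element f) \<longleftrightarrow> (\<forall>v. f v \<le> 1)"
proof -
  assume f: "adm f"
  have d: "distinct us \<longleftrightarrow> (\<forall>v. f v \<le> 1)" if "us \<in> element f" for us
  proof -
    have "count_list us v = (if v \<in> set us then 1 else 0) \<longleftrightarrow> count_list us v \<le> 1" for v
      using count_list_0_iff[of us v] by auto
    then show ?thesis by (simp add: distinct_count_atmost_1 count_mset element_mset[OF f that])
  qed
  then show ?thesis using element_nonempty[OF f] by (auto simp: multiplicity_free_def)
qed

lemma multiplicity_free_admissible:
  assumes "X \<in> admissible_elements D c" "multiplicity_free X" shows "X = element (indicator_fun (Supp X))"
proof -
  obtain f where f: "adm f" "X = element f" using assms by (auto simp: admissible_elements_eq)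
  have "f v = indicator_fun (Supp X) v" for v
  proof -
    have "f v \<le> 1" using multiplicity_free_element[OF f(1)] assms(2) f(2) by simp
    moreover have "v \<in> Supp X \<longleftrightarrow> 0 < f v" using Supp_element[OF f(1)] f(2) by simp
    ultimately show ?thesis by (simp add: indicator_fun_def)
  qed
  then show ?thesis using f by (metis ext)
qed

text \<open>The multiplicity of \<open>v\<close> in \<open>W_{r,x}\<close>: one for each factor
  whose support contains \<open>v\<close>.\<close>

definition level :: "'v \<Rightarrow> nat \<Rightarrow> 'v \<Rightarrow> nat" where
  "level x r v = card {i. i < r \<and> v \<in> hull_iter x i}"

lemma level_0: "level x 0 = null" by (simp add: level_def fun_eq_iff)

lemma level_Suc: "level x (Suc r) v = level x r v + of_bool (v \<in> hull_iter x r)"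
proof -
  have "{i. i < Suc r \<and> v \<in> hull_iter x i} = {i. i < r \<and> v \<in> hull_iter x i} \<union> (if v \<in> hull_iter x r then {r} else {})"
    by (auto simp: less_Suc_eq)
  then show ?thesis by (simp add: level_def)
qed

lemma level_le: "level x r v \<le> r"
  using card_mono[of "{..<r}" "{i. i < r \<and> v \<in> hull_iter x i}"] by (auto simp: level_def)

text \<open>For an arrow from a to b, a filter containing a contains b, and the hull of a filter
  containing b contains a. So the indices of the sets containing b, moved up by one, are indices of
  sets containing a.\<close>

lemma adm_level: "adm (level x r)"
  unfolding adm_def
proof (intro conjI allI impI)
  show "level x r v = 0" if "v \<notin> V" for v
    using that hull_iter_verts by (auto simp: level_def)
  fix a b assume ab: "(a, b) \<in> A"
  then have "a \<in> hull_iter x i \<Longrightarrow> b \<in> hull_iter x i" for i using hull_iter_filter by (auto simp: is_filter_iff)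
  then show "level x r a \<le> level x r b" unfolding level_def by (intro card_mono) auto
  have h: "b \<in> hull_iter x i \<Longrightarrow> a \<in> hull_iter x (Suc i)" for i
    using hull_edge ab arrows_edges hull_iter_Suc by blast
  have "level x r b = card (Suc ` {i. i < r \<and> b \<in> hull_iter x i})"
    unfolding level_def by (subst card_image) auto
  also have "\<dots> \<le> level x (Suc r) a" unfolding level_def using h by (intro card_mono) auto
  finally show "level x r b \<le> Suc (level x r a)"
    by (cases "a \<in> hull_iter x r") (simp_all add: level_Suc)
qed

text \<open>Whether a vertex is a sink depends only on the differences between its count and those
  of its neighbours; a common shift does not affect them.\<close>

lemma walk_shift:
  assumes "walk f xs" "adm g" "\<And>w. w \<in> set xs \<or> (\<exists>y\<in>set xs. (y, w) \<in> E) \<Longrightarrow> g w = f w + k"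
  shows "walk g xs"
  using assms
proof (induction xs arbitrary: f g)
  case (Cons x xs)
  have x: "addable f x" using Cons.prems(1) by simp
  have gx: "g x = f x + k" using Cons.prems(3)[of x] by simp
  have ag: "addable g x" unfolding addable_def
  proof (intro conjI allI impI)
    fix w assume "(x, w) \<in> E"
    then show "g w = g x + of_bool ((x, w) \<in> A)"
      using addable_edge[OF x, of w] Cons.prems(3)[of w] gx by auto
  qed (use Cons.prems(2) x addable_verts in auto)
  have "walk (bump g x) xs"
  proof (rule Cons.IH)
    show "walk (bump f x) xs" using Cons.prems(1) by simp
    show "bump g x w = bump f x w + k" if "w \<in> set xs \<or> (\<exists>y\<in>set xs. (y, w) \<in> E)" for w
      using Cons.prems(3)[of w] that by (auto simp: bump_apply)
  qed (rule adm_bump[OF ag])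
  then show ?case using ag by simp
qed simp

lemma word_prod_graph_monoid:
  "uss \<in> lists (lists V) \<Longrightarrow> word_prod (graph_monoid D) (map word_class uss) = word_class (concat uss)"
proof (induction uss)
  case Nil
  then show ?case by (simp add: one_graph_monoid)
next
  case (Cons us uss)
  then have "concat uss \<in> lists V" by (auto simp: in_lists_conv_set)
  then show ?case using Cons by (auto simp: word_class_mult)
qed

text \<open>The set added in the step from \<open>r\<close> to \<open>Suc r\<close> is the largest
  one and its letters are applied first, so the word built so far has to be walked on top of it. By
  the definition of the hull the new set contains all letters of that word and their neighbours, and
  \<open>walk_shift\<close> applies with shift 1.\<close>

lemma word_prod_level:
  "word_prod (graph_monoid D) (map (\<lambda>i. element (indicator_fun (hull_iter x i))) [0..<r]) = element (level x r)"
proof -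
  define ws where "ws i = word_of (indicator_fun (hull_iter x i))" for i
  have ai: "adm (indicator_fun (hull_iter x i))" for i by (rule adm_indicator[OF hull_iter_filter])
  have wl: "rev (ws i) \<in> lists V" for i unfolding ws_def by (rule word_of_rev[OF ai])
  have cl: "concat (map (\<lambda>i. rev (ws i)) is) \<in> lists V" for "is" using wl by (auto simp: in_lists_conv_set)
  have "word_prod (graph_monoid D) (map (\<lambda>i. element (indicator_fun (hull_iter x i))) [0..<r])
     = word_class (concat (map (\<lambda>i. rev (ws i)) [0..<r]))"
    using word_prod_graph_monoid[of "map (\<lambda>i. rev (ws i)) [0..<r]"] wl
    by (simp add: comp_def element_def ws_def in_lists_conv_set)
  also have "\<dots> = element (level x r)"
  proof (induction r)
    case 0
    then show ?case using element_walk[of "[]" null] by (simp add: level_0)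
  next
    case (Suc r)
    define xs where "xs = word_of (level x r)"
    have xs: "walk null xs" "bumps null xs = level x r" "xs \<in> lists V"
      unfolding xs_def using word_of adm_level by blast+
    have w: "walk null (ws r)" "bumps null (ws r) = indicator_fun (hull_iter x r)"
      unfolding ws_def using word_of ai by blast+
    have "walk (indicator_fun (hull_iter x r)) xs"
    proof (rule walk_shift[OF xs(1) ai, where k = 1])
      have in_r: "y \<in> hull_iter x (r - 1) \<and> 0 < r" if "y \<in> set xs" for y
      proof -
        have "count_list xs y \<noteq> 0" using that by (simp add: count_list_0_iff)
        then have "level x r y \<noteq> 0" using fun_cong[OF xs(2), of y] by (simp add: bumps_apply)
        then obtain i where "i < r" "y \<in> hull_iter x i" unfolding level_def by (metis (mono_tags, lifting) card.empty empty_Collect_eq)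
        moreover from \<open>i < r\<close> have "i \<le> r - 1" "0 < r" by simp_all
        ultimately show ?thesis using hull_iter_mono[of i "r - 1" x] by blast
      qed
      fix z assume z: "z \<in> set xs \<or> (\<exists>y\<in>set xs. (y, z) \<in> E)"
      have "z \<in> hull_iter x r"
      proof (cases "z \<in> set xs")
        case True
        then show ?thesis using in_r[OF True] hull_iter_mono[of "r - 1" r x] by auto
      next
        case False
        then obtain y where y: "y \<in> set xs" "(z, y) \<in> E" using z edges_sym by blast
        then have "z \<in> fhull (hull_iter x (r - 1))" using in_r hull_edge by blast
        then show ?thesis using in_r[OF y(1)] by (simp flip: hull_iter_Suc)
      qed
      then show "indicator_fun (hull_iter x r) z = null z + 1" by (simp add: indicator_fun_def)
    qed
    moreover have "bumps (indicator_fun (hull_iter x r)) xs = level x (Suc r)"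
      using fun_cong[OF xs(2)] by (auto simp: bumps_apply level_Suc indicator_fun_def fun_eq_iff)
    ultimately have "element (level x (Suc r)) = word_class (rev (ws r @ xs))"
      using w by (intro element_walk) simp_all
    also have "\<dots> = word_class (rev xs) \<otimes>\<^bsub>graph_monoid D\<^esub> word_class (rev (ws r))"
      using word_class_mult[OF rev_lists[OF xs(3)] wl] by simp
    also have "word_class (rev xs) = word_class (concat (map (\<lambda>i. rev (ws i)) [0..<r]))"
      using Suc by (simp add: element_def xs_def)
    also have "\<dots> \<otimes>\<^bsub>graph_monoid D\<^esub> word_class (rev (ws r)) = word_class (concat (map (\<lambda>i. rev (ws i)) [0..<Suc r]))"
      using word_class_mult[OF cl wl] by simp
    finally show ?case by simp
  qed
  finally show ?thesis .
qed

lemma principal_word_eq: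
  assumes r: "0 < r" shows "principal_word D c r x = element (level x r)"
proof -
  have prod: "word_prod (graph_monoid D) (map X (rev [1..<Suc r])) = element (level x r)"
    if "\<And>j. j < r \<Longrightarrow> X (r - j) = element (indicator_fun (hull_iter x j))" for X
  proof -
    have "map X (rev [1..<Suc r]) = map (\<lambda>i. element (indicator_fun (hull_iter x i))) [0..<r]"
    proof (rule nth_equalityI)
      fix i assume "i < length (map X (rev [1..<Suc r]))"
      then have i: "i < r" by (simp del: upt_Suc)
      then have "rev [1..<Suc r] ! i = r - i" by (subst rev_nth) (auto simp del: upt_Suc)
      then show "map X (rev [1..<Suc r]) ! i = map (\<lambda>i. element (indicator_fun (hull_iter x i))) [0..<r] ! i"
        using i that[OF i] by (simp del: upt_Suc)
    qed simp
    then show ?thesis using word_prod_level by simp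
  qed
  have ai: "adm (indicator_fun (hull_iter x i))" for i by (rule adm_indicator[OF hull_iter_filter])
  have Supp: "Supp (element (indicator_fun (hull_iter x i))) = hull_iter x i" for i
    by (simp add: Supp_element[OF ai] indicator_fun_def)
  show ?thesis
    unfolding principal_word_def
  proof (rule the_equality)
    define X where "X j = element (indicator_fun (hull_iter x (r - j)))" for j
    have "multiplicity_free (X j) \<and> X j \<in> admissible_elements D c" for j
      unfolding X_def multiplicity_free_element[OF ai] admissible_elements_eq using ai by (auto simp: indicator_fun_def)
    moreover have "Supp (X r) = principal_filter D c x" unfolding X_def Supp by (simp add: hull_iter_0)
    moreover have "fhull (Supp (X (Suc j))) = Supp (X j)" if "j < r" for j
      unfolding X_def Supp using that by (simp flip: hull_iter_Suc add: Suc_diff_Suc)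
    moreover have "word_prod (graph_monoid D) (map X (rev [1..<Suc r])) = element (level x r)"
      by (rule prod) (simp add: X_def)
    ultimately show "\<exists>X. (\<forall>j\<in>{1..r}. multiplicity_free (X j) \<and> X j \<in> admissible_elements D c) \<and>
        Supp (X r) = principal_filter D c x \<and>
        (\<forall>j. 0 < j \<and> j < r \<longrightarrow> fhull (Supp (X (Suc j))) = Supp (X j)) \<and>
        element (level x r) = word_prod (graph_monoid D) (map X (rev [1..<Suc r]))" by metis
  next
    fix W assume "\<exists>X. (\<forall>j\<in>{1..r}. multiplicity_free (X j) \<and> X j \<in> admissible_elements D c) \<and>
        Supp (X r) = principal_filter D c x \<and>
        (\<forall>j. 0 < j \<and> j < r \<longrightarrow> fhull (Supp (X (Suc j))) = Supp (X j)) \<and>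
        W = word_prod (graph_monoid D) (map X (rev [1..<Suc r]))"
    then obtain X where X: "\<forall>j\<in>{1..r}. multiplicity_free (X j) \<and> X j \<in> admissible_elements D c"
      "Supp (X r) = principal_filter D c x"
      "\<forall>j. 0 < j \<and> j < r \<longrightarrow> fhull (Supp (X (Suc j))) = Supp (X j)"
      "W = word_prod (graph_monoid D) (map X (rev [1..<Suc r]))"
      by blast
    have S: "Supp (X (r - j)) = hull_iter x j" if "j < r" for j
      using that
    proof (induction j)
      case 0
      then show ?case using X(2) by (simp add: hull_iter_0)
    next
      case (Suc j)
      have "Supp (X (r - Suc j)) = fhull (Supp (X (Suc (r - Suc j))))" using X(3) Suc.prems by simp
      also have "Suc (r - Suc j) = r - j" using Suc by simp
      finally show ?case using Suc by (simp add: hull_iter_Suc)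
    qed
    have "X (r - j) = element (indicator_fun (hull_iter x j))" if "j < r" for j
      using multiplicity_free_admissible[of "X (r - j)"] X(1) that S[OF that] by simp
    then show "W = element (level x r)" using prod X(4) by simp
  qed
qed

lemma rtrancl_arrows: "(x, y) \<in> A\<^sup>* \<Longrightarrow> x = y \<or> position x < position y"
  by (induction rule: rtrancl_induct) (auto simp: arrows_iff)

lemma hull_iter_refl: "x \<in> V \<Longrightarrow> x \<in> hull_iter x i"
  using hull_iter_mono[of 0 i x] by (auto simp: hull_iter_0 principal_filter_def)

lemma level_self: "x \<in> V \<Longrightarrow> level x r x = r"
  by (simp add: level_def hull_iter_refl)

lemma level_mono: "i \<le> r \<Longrightarrow> level x i \<le> level x r"
  unfolding level_def le_fun_def by (auto intro!: card_mono)

text \<open>The counts at adjacent vertices differ by at most one, so each hull step costs at most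
  one: \<open>r \<le> g v + i\<close> on \<open>hull_iter x i\<close>. Hence \<open>v\<close> can
  lie only in the sets with index at least \<open>r - g v\<close>, and at most \<open>g v\<close> of
  these are below \<open>r\<close>.\<close>

lemma level_least:
  assumes "adm g" "r \<le> g x" shows "level x r \<le> g"
proof (rule le_funI)
  fix v
  have *: "\<forall>v\<in>hull_iter x i. r \<le> g v + i" for i
  proof (induction i)
    case 0
    have "g x \<le> g y" if "(x, y) \<in> A\<^sup>*" for y
      using that by (induction rule: rtrancl_induct) (use adm_arrow[OF assms(1)] order_trans in blast)+
    then show ?case using assms(2) by (auto simp: hull_iter_0 principal_filter_def intro: le_trans)
  next
    case (Suc i)
    have "fhull (hull_iter x i) \<subseteq> {v \<in> V. r \<le> g v + Suc i}"
    proof (rule hull_least)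
      show "is_filter D c {v \<in> V. r \<le> g v + Suc i}"
        unfolding is_filter_iff using adm_arrow[OF assms(1)] arrows_edges edges_verts by fastforce
      show "hull_iter x i \<subseteq> {v \<in> V. r \<le> g v + Suc i}" using Suc hull_iter_verts by fastforce
      fix v w assume vw: "(v, w) \<in> E" "w \<in> hull_iter x i"
      then have "g w \<le> Suc (g v)"
        using adm_arrow[OF assms(1), of v w] adm_arrow[OF assms(1), of w v] arrows_total[OF vw(1)]
        by (cases "(v, w) \<in> A") auto
      moreover have "r \<le> g w + i" using Suc vw(2) by blast
      ultimately show "v \<in> {v \<in> V. r \<le> g v + Suc i}" using edges_verts[OF vw(1)] by auto
    qed
    then show ?case unfolding hull_iter_Suc by blast
  qed
  have "{i. i < r \<and> v \<in> hull_iter x i} \<subseteq> {r - g v..<r}" using * by fastforce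
  then have "level x r v \<le> card {r - g v..<r}" unfolding level_def by (intro card_mono) auto
  then show "level x r v \<le> g v" by simp
qed

text \<open>\<open>r\<close> is the largest value of the function, and it is attained only on the
  principal filter of \<open>x\<close>. Two vertices lying in the principal filters of each other
  coincide, as the quiver is acyclic.\<close>

lemma level_unique:
  assumes "x \<in> V" "y \<in> V" "0 < r" "0 < s" "level x r = level y s"
  shows "r = s \<and> x = y"
proof -
  have "r \<le> s" using level_le[of y s x] level_self[OF assms(1), of r] assms(5) by simp
  moreover have "s \<le> r" using level_le[of x r y] level_self[OF assms(2), of s] assms(5) by simp
  ultimately have rs: "r = s" by simp
  have *: "(a, b) \<in> A\<^sup>*" if "level a r b = r" for a b
  proof -
    have "{i. i < r \<and> b \<in> hull_iter a i} = {..<r}"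
      using that unfolding level_def by (intro card_subset_eq) auto
    then have "b \<in> hull_iter a 0" using assms(3) by blast
    then show ?thesis by (simp add: hull_iter_0 principal_filter_def)
  qed
  have "(x, y) \<in> A\<^sup>*" "(y, x) \<in> A\<^sup>*"
    using *[of x y] *[of y x] level_self[OF assms(1)] level_self[OF assms(2)] assms(5) rs by metis+
  then have "x = y" using rtrancl_arrows[of x y] rtrancl_arrows[of y x] by auto
  then show ?thesis using rs by simp
qed

text \<open>The tail of an arrow into \<open>x\<close> lies outside the principal filter of
  \<open>x\<close>, so its count is at most \<open>r - 1\<close>. Therefore the last
  \<open>x\<close> can be taken away.\<close>

lemma level_last:
  assumes x: "x \<in> V" and r: "0 < r"
  obtains g where "addable g x" "bump g x = level x r"
proof -
  define g where "g = (level x r)(x := r - 1)"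
  have b: "bump g x = level x r" using level_self[OF x, of r] r by (auto simp: g_def bump_def fun_eq_iff)
  have "adm g" unfolding adm_def
  proof (intro conjI allI impI)
    show "g v = 0" if "v \<notin> V" for v using that x adm_outside[OF adm_level] by (auto simp: g_def)
    fix a b' assume ab: "(a, b') \<in> A"
    then have ne: "a \<noteq> b'" using arrows_edges edges_verts by blast
    have ad: "level x r a \<le> level x r b' \<and> level x r b' \<le> Suc (level x r a)" using adm_arrow[OF adm_level ab] .
    have "g a \<le> g b' \<and> g b' \<le> Suc (g a)"
    proof (cases "a = x")
      case True
      then show ?thesis using ne ad level_self[OF x, of r] level_le[of x r b'] r by (simp add: g_def)
    next
      case a: False
      show ?thesis
      proof (cases "b' = x")
        case True
        have "a \<notin> hull_iter x 0"
          using rtrancl_arrows[of x a] ab a True by (auto simp: hull_iter_0 principal_filter_def arrows_iff)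
        then have "{i. i < r \<and> a \<in> hull_iter x i} \<subseteq> {1..<r}"
          by (auto simp: Suc_le_eq intro!: gr0I)
        then have "level x r a \<le> card {1..<r}" unfolding level_def by (intro card_mono) auto
        then show ?thesis using True a ad level_self[OF x, of r] by (simp add: g_def) arith
      next
        case False
        then show ?thesis using a ad by (simp add: g_def)
      qed
    qed
    then show "g a \<le> g b'" "g b' \<le> Suc (g a)" by auto
  qed
  then have "addable g x" using addableI[OF _ x] b adm_level by simp
  then show thesis using that b by blast
qed

text \<open>The reflection at x sends -\<alpha>_x to \<alpha>_x, so the expression in (c), formed
  after the last letter, is the root attached to that letter.\<close>

lemma inv_transport_bump:
  assumes "addable g x" shows "inv_transport (bump g x) (- vroot x) = inv_transport g (vroot x)"
proof (rule inv_transport_eqI[OF adm_bump[OF assms]])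
  show "transport (bump g x) (inv_transport g (vroot x)) = - vroot x"
    using transport_bump[OF assms] transport_inv_transport[OF addable_adm[OF assms]]
      reflection_simple[OF rho_gens[OF addable_verts[OF assms]]] by simp
qed

text \<open>With \<open>r = f x\<close> for the last letter \<open>x\<close>,
  \<open>level_least\<close> puts \<open>level x r\<close> below \<open>f\<close>. If a walk from
  there to \<open>f\<close> were nonempty, its last letter would again be \<open>x\<close>, because
  \<beta> determines the last letter; but \<open>x\<close> already occurs \<open>r\<close> times at
  the start of that walk.\<close>

lemma least_negator_level:
  assumes b: "pos_root D \<beta>" and f: "f \<in> neg_set \<beta>" "\<And>g. g \<in> neg_set \<beta> \<Longrightarrow> f \<le> g"
  shows "\<exists>x\<in>V. \<exists>r>0. f = level x r \<and> \<beta> = inv_transport f (- vroot x)"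
proof -
  have br: "\<beta> \<in> roots D" using b by (simp add: pos_root_def)
  have af: "adm f" and nf: "neg_root D (transport f \<beta>)" using f by (auto simp: neg_set_def)
  have last: "transport f \<beta> = - vroot z" if z: "addable g z" "bump g z = f" for g z
  proof -
    have ag: "adm g" and zV: "z \<in> V" using z addable_adm addable_verts by blast+
    have "g \<notin> neg_set \<beta>"
    proof
      assume "g \<in> neg_set \<beta>"
      then show False using le_funD[OF f(2), of g z] z(2) by (auto simp: bump_apply)
    qed
    then have "pos_root D (transport g \<beta>)" using ag root_pos_neg[OF transport_roots[OF ag br]] by (simp add: neg_set_def)
    moreover have t: "transport f \<beta> = reflection D (rho D z) (transport g \<beta>)" using transport_bump[OF z(1)] z(2) by simp
    ultimately have "transport g \<beta> = vroot z" using reflection_makes_negative rho_gens[OF zV] nf by simp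
    then show ?thesis using t reflection_simple[OF rho_gens[OF zV]] by simp
  qed
  have "word_of f \<noteq> []"
  proof
    assume "word_of f = []"
    then have "transport f \<beta> = \<beta>" by (simp add: transport_def)
    then show False using nf b root_pos_neg[OF br] by simp
  qed
  then obtain ws x where ws: "word_of f = ws @ [x]" by (metis rev_exhaust)
  define g where "g = bumps null ws"
  have g: "addable g x" "bump g x = f" using word_of[OF af] ws by (auto simp: g_def)
  have x: "x \<in> V" using g addable_verts by blast
  define r where "r = f x"
  have r: "r > 0" using g(2) by (auto simp: r_def bump_def)
  have "level x r \<le> f" by (rule level_least[OF af]) (simp add: r_def)
  then obtain zs where zs: "walk (level x r) zs" "bumps (level x r) zs = f" using walk_extend[OF adm_level af] by blast
  have "f = level x r"
  proof (cases zs rule: rev_cases)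
    case Nil
    then show ?thesis using zs by simp
  next
    case (snoc zs' z)
    define g' where "g' = bumps (level x r) zs'"
    have g': "addable g' z" "bump g' z = f" using zs snoc by (auto simp: g'_def)
    have "r \<le> g' x" using bumps_ge[of "level x r" x zs'] level_self[OF x, of r] by (simp add: g'_def)
    then have "z \<noteq> x" using g'(2) by (auto simp: bump_def r_def)
    moreover have "vroot z = vroot x" using last[OF g'] last[OF g]
      by (metis neg_equal_iff_equal uminus_apply ext)
    then have "vroot z (rho D x) = 1" using root_apply[OF x x] by simp
    then have "z = x" using root_apply[OF addable_verts[OF g'(1)] x] by (simp split: if_splits)
    ultimately show ?thesis by blast
  qed
  moreover have "\<beta> = inv_transport f (- vroot x)" using last[OF g] inv_transport_eqI[OF af] by metis
  ultimately show ?thesis using x r by blast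
qed


section \<open>Least negators as elements of the graph monoid\<close>

lemma nu_element:
  assumes f: "f \<in> neg_set \<beta>" "\<And>g. g \<in> neg_set \<beta> \<Longrightarrow> f \<le> g"
  shows "least (prec_order D) W (negators D \<beta> \<inter> admissible_elements D c) \<longleftrightarrow> W = element f"
    and "nu D c \<beta> = element f" and "prec_minimal D (element f) (negators D \<beta>)"
proof -
  have ad: "adm g" if "g \<in> neg_set \<beta>" for g using that by (simp add: neg_set_def)
  show l: "least (prec_order D) W (negators D \<beta> \<inter> admissible_elements D c) \<longleftrightarrow> W = element f" for W
    unfolding negators_admissible by (rule least_element[OF ad f])
  show "nu D c \<beta> = element f" unfolding nu_def l by simp
  have neg: "element g \<in> negators D \<beta> \<longleftrightarrow> g \<in> neg_set \<beta>" if "adm g" for g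
    using that negates_element element_carrier by (simp add: negators_def)
  show "prec_minimal D (element f) (negators D \<beta>)"
  proof (rule minimal_element[OF ad[OF f(1)]])
    show "element f \<in> negators D \<beta>" using neg[OF ad[OF f(1)]] f(1) by simp
    show "negators D \<beta> \<subseteq> carrier (graph_monoid D)" by (auto simp: negators_def)
    show "f \<le> g" if "adm g" "element g \<in> negators D \<beta>" for g using f(2) neg that by simp
  qed
qed

lemma xi_element:
  assumes conn: "coxeter_irreducible D" and fin: "finite \<Psi>" and ne: "\<Psi> \<noteq> {}"
    and P: "\<Psi> \<subseteq> preprojective_roots D c"
  shows "\<exists>f. adm f \<and> (\<forall>W. least (prec_order D) W (set_negators D \<Psi> \<inter> admissible_elements D c) \<longleftrightarrow> W = element f) \<and>
    xi D c \<Psi> = element f \<and> prec_minimal D (element f) (set_negators D \<Psi>)"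
proof -
  define N where "N = {f. adm f \<and> (\<forall>\<beta>\<in>\<Psi>. f \<in> neg_set \<beta>)}"
  have pos: "pos_root D \<beta> \<and> neg_set \<beta> \<noteq> {}" if "\<beta> \<in> \<Psi>" for \<beta> using P that preprojective_iff by blast
  have "N \<noteq> {}" using common_negator[OF conn fin pos] unfolding N_def by blast
  moreover have ad: "adm f" if "f \<in> N" for f using that by (simp add: N_def)
  moreover have "(\<lambda>v. min (f v) (g v)) \<in> N" if "f \<in> N" "g \<in> N" for f g
    using that adm_min neg_set_min[of _ f g] pos by (simp add: N_def pos_root_def)
  ultimately have "\<exists>f\<in>N. \<forall>g\<in>N. f \<le> g" by (rule least_adm)
  then obtain f where f: "f \<in> N" "\<And>g. g \<in> N \<Longrightarrow> f \<le> g" by blast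
  have l: "least (prec_order D) W (set_negators D \<Psi> \<inter> admissible_elements D c) \<longleftrightarrow> W = element f" for W
    unfolding set_negators_admissible N_def[symmetric] by (rule least_element[OF ad f])
  have neg: "element g \<in> set_negators D \<Psi> \<longleftrightarrow> g \<in> N" if "adm g" for g
    using that negates_element element_carrier by (simp add: set_negators_def N_def)
  have "prec_minimal D (element f) (set_negators D \<Psi>)"
  proof (rule minimal_element[OF ad[OF f(1)]])
    show "element f \<in> set_negators D \<Psi>" using neg[OF ad[OF f(1)]] f(1) by simp
    show "set_negators D \<Psi> \<subseteq> carrier (graph_monoid D)" by (auto simp: set_negators_def)
    show "f \<le> g" if "adm g" "element g \<in> set_negators D \<Psi>" for g using f(2) neg that by simp
  qed
  moreover have "xi D c \<Psi> = element f" unfolding xi_def l using ne by simp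
  ultimately show ?thesis using l ad f(1) by blast
qed

lemma preprojective_level:
  assumes "\<beta> \<in> preprojective_roots D c"
  obtains x r where "x \<in> V" "0 < r" "level x r \<in> neg_set \<beta>" "\<forall>g\<in>neg_set \<beta>. level x r \<le> g"
    "nu D c \<beta> = element (level x r)" "\<beta> = inv_transport (level x r) (- vroot x)"
proof -
  have b: "pos_root D \<beta>" "neg_set \<beta> \<noteq> {}" using assms preprojective_iff by blast+
  obtain f where f: "f \<in> neg_set \<beta>" "\<And>g. g \<in> neg_set \<beta> \<Longrightarrow> f \<le> g" using least_negator[OF b] by blast
  obtain x r where "x \<in> V" "0 < r" "f = level x r" "\<beta> = inv_transport f (- vroot x)"
    using least_negator_level[OF b(1) f] by blast
  then show thesis using that f nu_element(2)[OF f] by blast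
qed

lemma nu_level:
  assumes "\<beta> \<in> preprojective_roots D c"
  shows "\<exists>x\<in>V. \<exists>r>0. nu D c \<beta> = element (level x r) \<and> \<beta> = inv_transport (level x r) (- vroot x)"
  by (rule preprojective_level[OF assms]) blast

lemma nu_principal_iff:
  assumes "x \<in> V" "0 < r" "nu D c \<beta> = element (level x r)" "y \<in> V" "0 < s"
  shows "nu D c \<beta> = principal_word D c s y \<longleftrightarrow> s = r \<and> y = x"
  using level_unique[OF assms(1,4,2,5)] element_inj[OF adm_level adm_level, of x r y s] assms(3)
    principal_word_eq[OF assms(5), of y] by auto

end

theorem theorem2p4:
  fixes D :: "('g, 'v) coxeter_datum" and c :: 'g
    and \<alpha> :: "'g \<Rightarrow> real" and \<Psi> :: "('g \<Rightarrow> real) set"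
  assumes "coxeter_system D" and "finite (gens D)" and "coxeter_irreducible D"
    and "coxeter_element D c"
    and "\<alpha> \<in> preprojective_roots D c"
    and "finite \<Psi>" and "\<Psi> \<noteq> {}" and "\<Psi> \<subseteq> preprojective_roots D c"
  shows
    \<comment> \<open>(a)\<close>
    "(\<exists>!W. least (prec_order D) W (negators D \<alpha> \<inter> admissible_elements D c)) \<and>
     least (prec_order D) (nu D c \<alpha>) (negators D \<alpha> \<inter> admissible_elements D c) \<and>
     prec_minimal D (nu D c \<alpha>) (negators D \<alpha>) \<and>
     (\<exists>!W. least (prec_order D) W (set_negators D \<Psi> \<inter> admissible_elements D c)) \<and>
     least (prec_order D) (xi D c \<Psi>) (set_negators D \<Psi> \<inter> admissible_elements D c) \<and>
     prec_minimal D (xi D c \<Psi>) (set_negators D \<Psi>) \<and>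
     nu D c \<in> preprojective_roots D c \<rightarrow> admissible_elements D c \<and>
     xi D c \<in> finite_preprojective_sets D c \<rightarrow> admissible_elements D c \<and>
     (\<forall>\<beta> \<in> preprojective_roots D c. xi D c {\<beta>} = nu D c \<beta>) \<and>
     \<comment> \<open>(b)\<close>
     nu D c ` preprojective_roots D c \<subseteq> principal_elements D c \<and>
     (\<exists>!(r, x). 0 < r \<and> x \<in> verts D \<and> nu D c \<alpha> = principal_word D c r x) \<and>
     \<comment> \<open>(c)\<close>
     (\<forall>r x. 0 < r \<and> x \<in> verts D \<and> nu D c \<alpha> = principal_word D c r x \<longrightarrow>
        \<alpha> = act D (rho_hom D (word_transpose (principal_word D c r x)))
              (- simple_root (rho D x)) \<and>
        (\<forall>i. 0 < i \<and> i < r \<longrightarrow>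
           pos_root D (act D (rho_hom D (word_transpose (principal_word D c i x)))
                         (- simple_root (rho D x))))) \<and>
     \<comment> \<open>(d)\<close>
     inj_on (nu D c) (preprojective_roots D c)"
proof -
  interpret coxeter_quiver D c using assms(1,2,4) by unfold_locales
  note conn = assms(3)
  obtain x r where xr: "x \<in> V" "0 < r" "level x r \<in> neg_set \<alpha>" "\<forall>g\<in>neg_set \<alpha>. level x r \<le> g"
    "nu D c \<alpha> = element (level x r)" "\<alpha> = inv_transport (level x r) (- vroot x)"
    by (rule preprojective_level[OF assms(5)])
  note nu = nu_element[OF xr(3) bspec[OF xr(4)]]
  obtain F where F: "adm F"
    "\<And>W. least (prec_order D) W (set_negators D \<Psi> \<inter> admissible_elements D c) \<longleftrightarrow> W = element F"
    "xi D c \<Psi> = element F" "prec_minimal D (element F) (set_negators D \<Psi>)"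
    using xi_element[OF conn assms(6-8)] by blast
  have a1: "\<exists>!W. least (prec_order D) W (negators D \<alpha> \<inter> admissible_elements D c)"
    and a2: "least (prec_order D) (nu D c \<alpha>) (negators D \<alpha> \<inter> admissible_elements D c)"
    and a3: "prec_minimal D (nu D c \<alpha>) (negators D \<alpha>)"
    using nu by simp_all
  have a4: "\<exists>!W. least (prec_order D) W (set_negators D \<Psi> \<inter> admissible_elements D c)"
    and a5: "least (prec_order D) (xi D c \<Psi>) (set_negators D \<Psi> \<inter> admissible_elements D c)"
    and a6: "prec_minimal D (xi D c \<Psi>) (set_negators D \<Psi>)"
    using F by simp_all
  have a7: "nu D c \<in> preprojective_roots D c \<rightarrow> admissible_elements D c"
  proof
    fix \<beta> assume "\<beta> \<in> preprojective_roots D c"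
    then obtain y s where "nu D c \<beta> = element (level y s)" using nu_level by blast
    then show "nu D c \<beta> \<in> admissible_elements D c" using adm_level by (auto simp: admissible_elements_eq)
  qed
  have a8: "xi D c \<in> finite_preprojective_sets D c \<rightarrow> admissible_elements D c"
  proof
    fix \<Phi> assume P: "\<Phi> \<in> finite_preprojective_sets D c"
    show "xi D c \<Phi> \<in> admissible_elements D c"
    proof (cases "\<Phi> = {}")
      case True
      then have "xi D c \<Phi> = element null"
        using element_walk[of "[]" null] by (simp add: xi_def one_graph_monoid)
      then show ?thesis using adm_zero by (auto simp: admissible_elements_eq)
    next
      case False
      then obtain f where "adm f" "xi D c \<Phi> = element f"
        using xi_element[OF conn _ False] P by (auto simp: finite_preprojective_sets_def)
      then show ?thesis by (auto simp: admissible_elements_eq)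
    qed
  qed
  have a9: "\<forall>\<beta> \<in> preprojective_roots D c. xi D c {\<beta>} = nu D c \<beta>"
    by (simp add: xi_def nu_def set_negators_def negators_def)
  have b1: "nu D c ` preprojective_roots D c \<subseteq> principal_elements D c"
  proof (rule image_subsetI)
    fix \<beta> assume "\<beta> \<in> preprojective_roots D c"
    then obtain y s where "y \<in> V" "0 < s" "nu D c \<beta> = element (level y s)" using nu_level by blast
    then show "nu D c \<beta> \<in> principal_elements D c"
      using principal_word_eq[of s y] unfolding principal_elements_def by (metis (mono_tags, lifting) insertCI mem_Collect_eq)
  qed
  note pr = nu_principal_iff[OF xr(1,2,5)]
  have b2: "\<exists>!(r, x). 0 < r \<and> x \<in> verts D \<and> nu D c \<alpha> = principal_word D c r x"
    by (rule ex1I[of _ "(r, x)"]) (use xr(1,2) pr in auto)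
  have c1: "\<forall>r x. 0 < r \<and> x \<in> verts D \<and> nu D c \<alpha> = principal_word D c r x \<longrightarrow>
        \<alpha> = act D (rho_hom D (word_transpose (principal_word D c r x)))
              (- simple_root (rho D x)) \<and>
        (\<forall>i. 0 < i \<and> i < r \<longrightarrow>
           pos_root D (act D (rho_hom D (word_transpose (principal_word D c i x)))
                         (- simple_root (rho D x))))"
  proof (intro allI impI)
    fix s y assume sy: "0 < s \<and> y \<in> verts D \<and> nu D c \<alpha> = principal_word D c s y"
    then have eq: "s = r" "y = x" using pr by blast+
    have tr: "act D (rho_hom D (word_transpose (principal_word D c i x))) v = inv_transport (level x i) v"
      if "0 < i" for i v using that by (simp add: principal_word_eq act_transpose adm_level)
    have "pos_root D \<alpha>" using assms(5) preprojective_iff by blast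
    then have red: "reduced (level x r)" using reduced_least[OF conn _ xr(3) bspec[OF xr(4)]] by blast
    \<comment> \<open>\<open>W_{i,x}\<close> is an initial part of the reduced word
      \<open>W_{r,x}\<close> and can be written with its i-th \<open>x\<close> as the last letter,
      so the root in question is attached to a letter of a reduced word.\<close>
    have "pos_root D (inv_transport (level x i) (- vroot x))" if i: "0 < i" "i < r" for i
    proof -
      obtain g where g: "addable g x" "bump g x = level x i" using level_last[OF xr(1) i(1)] .
      have "bump g x \<le> level x r" unfolding g(2) using i(2) by (intro level_mono) simp
      then have "pos_root D (inv_transport g (vroot x))" using red g(1) by (simp add: reduced_def)
      then show ?thesis using inv_transport_bump[OF g(1)] g(2) by simp
    qed
    then show "\<alpha> = act D (rho_hom D (word_transpose (principal_word D c s y))) (- simple_root (rho D y)) \<and>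
        (\<forall>i. 0 < i \<and> i < s \<longrightarrow>
           pos_root D (act D (rho_hom D (word_transpose (principal_word D c i y))) (- simple_root (rho D y))))"
      unfolding eq using tr xr(2,6) by simp
  qed
  have d1: "inj_on (nu D c) (preprojective_roots D c)"
  proof (rule inj_onI)
    fix \<beta> \<gamma> assume b: "\<beta> \<in> preprojective_roots D c" and g: "\<gamma> \<in> preprojective_roots D c"
      and eq: "nu D c \<beta> = nu D c \<gamma>"
    obtain y s where ys: "y \<in> V" "0 < s" "nu D c \<beta> = element (level y s)" "\<beta> = inv_transport (level y s) (- vroot y)"
      using nu_level[OF b] by blast
    obtain z t where zt: "z \<in> V" "0 < t" "nu D c \<gamma> = element (level z t)" "\<gamma> = inv_transport (level z t) (- vroot z)"
      using nu_level[OF g] by blast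
    \<comment> \<open>The element determines the pair of number and vertex, and the formula in (c)
      recovers the root from this pair.\<close>
    have "level y s = level z t" using element_inj[OF adm_level adm_level] ys(3) zt(3) eq by simp
    then have "s = t \<and> y = z" by (rule level_unique[OF ys(1) zt(1) ys(2) zt(2)])
    then show "\<beta> = \<gamma>" using ys(4) zt(4) by simp
  qed
  show ?thesis using a1 a2 a3 a4 a5 a6 a7 a8 a9 b1 b2 c1 d1 by blast
qed

end
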